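(* Let $\{\eta(t): t\in T\}$ be a non-negative stochastic process in the max-domain of attraction of the max-stable process $\xi$, normalized such that, for independent copies $\eta_1,\eta_2,\dots$ of $\eta$, $\frac{1}{n}\max_{i=1}^n \eta_i(t) \to \xi(t)$, $t\in T$, as $n\to\infty$ in the sense of finite-dimensional distributions (i.e. the norming functions are $c_n(t)=1/n$, $b_n(t)=0$). Let $a(n)\to\infty$ as $n\to\infty$. Then for every $k\in\mathbb{N}$ and $t_0,\dots,t_k\in T$ we have convergence in distribution on $\mathbb{R}^{k+1}$ $$\left(\frac{\eta(t_0)}{a(n)}, \frac{\eta(t_1)}{\eta(t_0)},\dots,\frac{\eta(t_k)}{\eta(t_0)} \ \Bigg|\ \eta(t_0) > a(n)\right) \xrightarrow{d} \left(Z, \Delta\tilde{\mathbf{V}}^{(1)}\right),\quad n\to\infty,$$ where $Z$ is a standard Pareto random variable independent of $\Delta\tilde{\mathbf{V}}^{(1)}$, and the law of $\Delta\tilde{\mathbf{V}}^{(1)}$ is given by $$\mathbb{P}(\Delta\tilde{\mathbf{V}}^{(1)}\in d\mathbf{z}) = (1-p)\,\mathbb{P}(\Delta\mathbf{V}^{(1)}\in d\mathbf{z})\,\mathbb{E}\bigl(V^{(1)}(t_0)\,\big|\,\Delta\mathbf{V}^{(1)}=\mathbf{z}\bigr),\quad \mathbf{z}\geq \mathbf{0},$$ with $\Delta\mathbf{V}^{(1)} = \left(\frac{V^{(1)}(t_1)}{V^{(1)}(t_0)},\dots,\frac{V^{(1)}(t_k)}{V^{(1)}(t_0)}\right)$ the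 vector of increments with respect to $t_0$.
   Context: $T$ is an arbitrary index set. The process $\{\xi(t): t\in T\}$ has standard Fréchet margins (distribution function $\exp(-1/x)$, $x\ge0$) and admits the representation $\xi(t)=\max_{i\in\mathbb{N}} U_i V_i(t)$, $t\in T$, where $\sum_{i\in\mathbb{N}}\delta_{U_i}$ is a Poisson point process on $(0,\infty)$ with intensity $u^{-2}\,du$ and $V_1,V_2,\dots$ are independent copies of a non-negative stochastic process $\{V(t): t\in T\}$ with $\mathbb{E}V(t)=1$ for all $t\in T$. For the fixed point $t_0\in T$, $p=\mathbb{P}(V(t_0)=0)$, and $V^{(1)}$ denotes the process $V$ conditioned on the event $\{V(t_0)>0\}$. *)

theory Defs
  imports "HOL-Probability.Probability"
begin

definition process_space :: "('t \<Rightarrow> real) measure" where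
  "process_space = PiM UNIV (\<lambda>_. borel)"

definition weak_conv_on ::
  "'x::topological_space set \<Rightarrow> (nat \<Rightarrow> 'x measure) \<Rightarrow> 'x measure \<Rightarrow> bool" where
  "weak_conv_on S \<mu>s \<mu> \<longleftrightarrow>
     (\<forall>f :: 'x \<Rightarrow> real. continuous_on S f \<and> bounded (f ` S) \<longrightarrow>
        (\<lambda>n. \<integral>x. f x \<partial>(\<mu>s n)) \<longlonglongrightarrow> (\<integral>x. f x \<partial>\<mu>))"

definition frechet_intensity :: "real measure" where
  "frechet_intensity = density lborel (\<lambda>u. ennreal (indicator {0<..} u / u\<^sup>2))"

definition frechet_ppp :: "'c measure \<Rightarrow> (nat \<Rightarrow> 'c \<Rightarrow> real) \<Rightarrow> bool" where
  "frechet_ppp P U \<longleftrightarrow>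
     (\<forall>i. U i \<in> borel_measurable P) \<and>
     (AE \<omega> in P. \<forall>i. 0 < U i \<omega>) \<and>
     (\<forall>A. A \<in> sets borel \<and> A \<subseteq> {0<..} \<and> emeasure frechet_intensity A < \<infinity> \<longrightarrow>
        (AE \<omega> in P. finite {i. U i \<omega> \<in> A}) \<and>
        (\<forall>n::nat. measure P {\<omega> \<in> space P. card {i. U i \<omega> \<in> A} = n} =
            exp (- measure frechet_intensity A) * measure frechet_intensity A ^ n / fact n)) \<and>
     (\<forall>(m::nat) (As :: nat \<Rightarrow> real set).
        (\<forall>j<m. As j \<in> sets borel \<and> As j \<subseteq> {0<..} \<and> emeasure frechet_intensity (As j) < \<infinity>) \<and>
        disjoint_family_on As {..<m} \<longrightarrow>
        prob_space.indep_vars P (\<lambda>_. count_space UNIV)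
           (\<lambda>j \<omega>. card {i. U i \<omega> \<in> As j}) {..<m})"

definition pareto :: "real measure" where
  "pareto = density lborel (\<lambda>z. ennreal (indicator {1..} z / z\<^sup>2))"

text \<open>Law of Delta V-tilde^(1) on R^{1..k} (functions on {1..k}):
  P(Delta V-tilde in dz) = (1-p) P(Delta V^(1) in dz) E(V^(1)(t0) | Delta V^(1) = z),
  i.e. A |-> (1-p) E[V^(1)(t0) 1{Delta V^(1) in A}], where V^(1) is V under the
  conditional probability given V(t0) > 0.\<close>
definition tilted_increments ::
  "'d measure \<Rightarrow> ('d \<Rightarrow> 't \<Rightarrow> real) \<Rightarrow> 't \<Rightarrow> nat \<Rightarrow> (nat \<Rightarrow> 't) \<Rightarrow> (nat \<Rightarrow> real) measure" where
  "tilted_increments Q V t0 k t =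
     (let p = measure Q {\<omega> \<in> space Q. V \<omega> t0 = 0};
          Q1 = uniform_measure Q {\<omega> \<in> space Q. 0 < V \<omega> t0}
      in distr (density Q1 (\<lambda>\<omega>. ennreal ((1 - p) * V \<omega> t0)))
               (PiM {1..k} (\<lambda>_. borel))
               (\<lambda>\<omega>. \<lambda>j\<in>{1..k}. V \<omega> (t j) / V \<omega> t0))"

end

theory Submission
  imports Defs
begin

text \<open>
  Let \<open>K\<close> be a finite set of pairs \<open>(s, r)\<close> with \<open>r > 0\<close>. By max-stability of \<open>\<xi>\<close>, inherited from the domain
  of attraction, \<open>P(\<forall>(s, r)\<in>K. \<xi>(s) \<le> r)\<close> is determined by the first-order behaviour of
  \<open>P(\<exists>(s, r)\<in>K. \<xi>(s) > c r)\<close> as \<open>c \<rightarrow> \<infinity>\<close>. With \<open>W = max\<^bsub>(s, r)\<in>K\<^esub> V(s) / r\<close> this event says that some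
  \<open>U\<^sub>i W\<^sub>i\<close> exceeds \<open>c\<close>, so its probability is at most \<open>E W / c\<close> by Campbell's formula; truncating \<open>W\<close> at \<open>b\<close> and
  using that the number of \<open>U\<^sub>i > c / b\<close> is Poisson gives the matching lower bound \<open>E min(W, b) / c - (b / c)\<^sup>2 / 2\<close>.
  Hence \<open>y P(\<exists>(s, r)\<in>K. \<eta>(s) > y r) \<rightarrow> E W\<close>, and a difference of two such limits identifies the limiting
  distribution function of \<open>\<eta> / a(n)\<close> given \<open>\<eta>(t\<^sub>0) > a(n)\<close> as
  \<open>E max(V(t\<^sub>0) - W, 0)\<close>, which is that of the Pareto variable times the tilted increments. Convergence holds off the
  coordinate hyperplanes, which is enough for weak convergence; the increments are a continuous function of the
  rescaled vector.
\<close>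

subsection \<open>Weak convergence from distribution functions\<close>

text \<open>That no \<open>U i * W i\<close> exceeds 1 is a void event of a marked Poisson process,
  with probability exp(- E W). Max-stability replaces the marking argument: if F is the joint
  distribution function of \<xi>, then F(r) = F(n r)^n = (1 - p_n)^n for all n > 0, where p_n is the
  probability that some \<xi>(s) exceeds n r. So only the limit of n p_n is needed, and at such
  levels the chance of two large points is of smaller order: a first moment and the law of one count
  suffice.

  The Pareto variable enters through P(Z c \<le> 1) = max(1 - c, 0) for c \<ge> 0. Weighted by
  V(t0), and with W homogeneous, this becomes max(V(t0) - W, 0). The weight also discards the event
  V(t0) = 0, where increments make no sense.

  V(s) may vanish with positive probability, so the limit can charge x_j = 0, where nothing is known
  about the distribution functions. Hence the convergence criterion works with boxes whose end
  points lie in a countable dense set that may avoid chosen values.\<close>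

lemma measure_tendsto_finite_UN:
  fixes \<mu>s :: "nat \<Rightarrow> 'x measure" and \<mu> :: "'x measure"
  assumes fin: "\<And>n. finite_measure (\<mu>s n)" "finite_measure \<mu>"
    and sets: "\<And>n. sets (\<mu>s n) = sets \<mu>"
    and A: "\<A> \<subseteq> sets \<mu>" "\<And>A B. A \<in> \<A> \<Longrightarrow> B \<in> \<A> \<Longrightarrow> A \<inter> B \<in> \<A>"
    and lim: "\<And>A. A \<in> \<A> \<Longrightarrow> (\<lambda>n. measure (\<mu>s n) A) \<longlonglongrightarrow> measure \<mu> A"
    and J: "finite J" "B ` J \<subseteq> \<A>"
  shows "(\<lambda>n. measure (\<mu>s n) (\<Union>j\<in>J. B j)) \<longlonglongrightarrow> measure \<mu> (\<Union>j\<in>J. B j)"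
  using J
proof (induction J arbitrary: B rule: finite_induct)
  case empty
  then show ?case by simp
next
  case (insert i J)
  have Bs: "B j \<in> sets \<mu>" if "j \<in> insert i J" for j
    using insert.prems A(1) that by auto
  \<comment> \<open>Inclusion-exclusion for one set. The last union is again indexed by
    \<open>J\<close>, over the family \<open>B i \<inter> B j\<close>, which stays in
    \<open>\<A>\<close>; hence the generalization over \<open>B\<close>.\<close>
  have split: "measure \<nu> (\<Union>j\<in>insert i J. B j)
      = measure \<nu> (B i) + measure \<nu> (\<Union>j\<in>J. B j) - measure \<nu> (\<Union>j\<in>J. B i \<inter> B j)"
    if "finite_measure \<nu>" "sets \<nu> = sets \<mu>" for \<nu>
  proof -
    interpret finite_measure \<nu> by fact
    have "(\<Union>j\<in>insert i J. B j) = B i \<union> ((\<Union>j\<in>J. B j) - B i)" by auto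
    moreover have "(\<Union>j\<in>J. B i \<inter> B j) = (\<Union>j\<in>J. B j) \<inter> B i" by auto
    moreover have U: "(\<Union>j\<in>J. B j) \<in> sets \<nu>" "B i \<in> sets \<nu>"
      using Bs insert.hyps that by auto
    moreover have "measure \<nu> (B i \<union> ((\<Union>j\<in>J. B j) - B i)) = measure \<nu> (B i) + measure \<nu> ((\<Union>j\<in>J. B j) - B i)"
      using U by (intro finite_measure_Union) auto
    moreover have "measure \<nu> ((\<Union>j\<in>J. B j) - B i) = measure \<nu> (\<Union>j\<in>J. B j) - measure \<nu> ((\<Union>j\<in>J. B j) \<inter> B i)"
      using U by (intro finite_measure_Diff') auto
    ultimately show ?thesis by simp
  qed
  show ?case
    unfolding split[OF fin(1) sets] split[OF fin(2) refl]
    using insert.prems A(2)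
    by (intro tendsto_add tendsto_diff lim insert.IH) auto
qed

text \<open>The lower half of the portmanteau theorem. Countability lets finite unions of members of
  \<open>\<A>\<close> increase to \<open>G\<close>, and continuity from below for
  \<open>\<mu>\<close> selects one that nearly exhausts \<open>G\<close>. Returning from that union
  to \<open>G\<close> by monotonicity is why only a lower bound results.\<close>

lemma measure_tendsto_open_lower:
  fixes \<mu>s :: "nat \<Rightarrow> 'x measure" and \<mu> :: "'x measure"
  assumes fin: "\<And>n. finite_measure (\<mu>s n)" "finite_measure \<mu>"
    and sets: "\<And>n. sets (\<mu>s n) = sets \<mu>"
    and A: "\<A> \<subseteq> sets \<mu>" "\<And>A B. A \<in> \<A> \<Longrightarrow> B \<in> \<A> \<Longrightarrow> A \<inter> B \<in> \<A>" "countable \<A>"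
    and lim: "\<And>A. A \<in> \<A> \<Longrightarrow> (\<lambda>n. measure (\<mu>s n) A) \<longlonglongrightarrow> measure \<mu> A"
    and G: "G = \<Union>{A \<in> \<A>. A \<subseteq> G}" and e: "e > 0"
  shows "\<forall>\<^sub>F n in sequentially. measure (\<mu>s n) G > measure \<mu> G - e"
proof (cases "G = {}")
  case True
  then show ?thesis using e by simp
next
  case False
  interpret \<mu>: finite_measure \<mu> by fact
  define \<B> where "\<B> = {A \<in> \<A>. A \<subseteq> G}"
  have ne: "\<B> \<noteq> {}" and cB: "countable \<B>"
    using False G A(3) by (auto simp: \<B>_def)
  define b where "b = from_nat_into \<B>"
  have b: "range b = \<B>" unfolding b_def using ne cB by (rule range_from_nat_into)
  have bA: "b i \<in> \<A>" "b i \<subseteq> G" "b i \<in> sets \<mu>" for i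
    using b A(1) by (auto simp: \<B>_def)
  have GU: "G = (\<Union>m. \<Union>i<m. b i)"
  proof -
    have "G = \<Union>(range b)" using G unfolding b \<B>_def .
    also have "\<dots> = (\<Union>m. \<Union>i<m. b i)" by auto
    finally show ?thesis .
  qed
  have "(\<lambda>m. measure \<mu> (\<Union>i<m. b i)) \<longlonglongrightarrow> measure \<mu> (\<Union>m. \<Union>i<m. b i)"
    using bA(3) by (intro \<mu>.finite_Lim_measure_incseq) (auto simp: incseq_def intro: less_le_trans)
  then have "\<forall>\<^sub>F m in sequentially. measure \<mu> (\<Union>i<m. b i) > measure \<mu> G - e"
    unfolding GU[symmetric] using e by (intro order_tendstoD(1)) auto
  then obtain m where m: "measure \<mu> (\<Union>i<m. b i) > measure \<mu> G - e"
    by (auto simp: eventually_sequentially)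
  have "(\<lambda>n. measure (\<mu>s n) (\<Union>i<m. b i)) \<longlonglongrightarrow> measure \<mu> (\<Union>i<m. b i)"
    by (rule measure_tendsto_finite_UN[OF fin sets A(1,2) lim]) (use bA in auto)
  from order_tendstoD(1)[OF this m] show ?thesis
  proof eventually_elim
    case (elim n)
    have "G \<in> sets \<mu>" unfolding GU using bA(3) by auto
    then have "measure (\<mu>s n) (\<Union>i<m. b i) \<le> measure (\<mu>s n) G"
      using bA(2) by (intro finite_measure.finite_measure_mono[OF fin(1)]) (auto simp: sets)
    then show ?case using elim by simp
  qed
qed

text \<open>Discrete layer-cake formula: the sum counts the grid points i/m strictly below
  \<open>x\<close>. There are ceiling(m x) - 1 of them, with \<open>nat\<close> absorbing the value
  -1 at x = 0, so the count is within 1 of m x.\<close>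

lemma layer_sum_bounds:
  fixes x :: real
  assumes "0 < m" "0 \<le> x" "x \<le> 1"
  shows "(\<Sum>i\<in>{1..m}. indicator {real i / real m<..} x) / real m \<le> x"
    and "x \<le> (\<Sum>i\<in>{1..m}. indicator {real i / real m<..} x) / real m + 1 / real m"
proof -
  define y where "y = real m * x"
  have y: "0 \<le> y" "y \<le> real m" using assms by (auto simp: y_def mult_left_le)
  have "{i \<in> {1..m}. real i / real m < x} = {1..nat (\<lceil>y\<rceil> - 1)}"
  proof (rule set_eqI)
    fix i
    have "real i / real m < x \<longleftrightarrow> real i < y" using assms by (simp add: y_def field_simps)
    moreover have "real i < y \<longleftrightarrow> int i < \<lceil>y\<rceil>" by (simp add: less_ceiling_iff)
    moreover have "\<lceil>y\<rceil> \<le> int m" using y by (simp add: ceiling_le_iff)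
    ultimately show "i \<in> {i \<in> {1..m}. real i / real m < x} \<longleftrightarrow> i \<in> {1..nat (\<lceil>y\<rceil> - 1)}"
      by auto
  qed
  moreover have "(\<Sum>i\<in>{1..m}. indicator {real i / real m<..} x) = real (card {i \<in> {1..m}. real i / real m < x})"
    by (auto simp: indicator_def sum.If_cases Int_def)
  ultimately have *: "(\<Sum>i\<in>{1..m}. indicator {real i / real m<..} x) = real (nat (\<lceil>y\<rceil> - 1))" by simp
  have "real (nat (\<lceil>y\<rceil> - 1)) \<le> y" "y \<le> real (nat (\<lceil>y\<rceil> - 1)) + 1"
    using y by linarith+
  then show "(\<Sum>i\<in>{1..m}. indicator {real i / real m<..} x) / real m \<le> x"
    "x \<le> (\<Sum>i\<in>{1..m}. indicator {real i / real m<..} x) / real m + 1 / real m"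
    unfolding * using assms(1) by (auto simp: y_def field_simps)
qed

text \<open>Only the m level sets at heights i/m are compared. Half of \<open>e\<close> pays for the
  discretization 1/m, the other half for the error on each level set, since an average of m errors
  is no larger than their common bound.\<close>

lemma integral_eventually_lower:
  fixes \<mu>s :: "nat \<Rightarrow> 'x measure" and \<mu> :: "'x measure" and f :: "'x \<Rightarrow> real"
  assumes fin: "\<And>n. prob_space (\<mu>s n)" "prob_space \<mu>"
    and sets: "\<And>n. sets (\<mu>s n) = sets \<mu>"
    and f[measurable]: "f \<in> borel_measurable \<mu>" and f01: "\<And>x. 0 \<le> f x \<and> f x \<le> 1"
    and lower: "\<And>e c. e > 0 \<Longrightarrow>
      \<forall>\<^sub>F n in sequentially. measure (\<mu>s n) {x \<in> space \<mu>. c < f x} > measure \<mu> {x \<in> space \<mu>. c < f x} - e"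
    and e: "e > 0"
  shows "\<forall>\<^sub>F n in sequentially. (\<integral>x. f x \<partial>\<mu>s n) > (\<integral>x. f x \<partial>\<mu>) - e"
proof -
  obtain m where m: "m > 0" "1 / real m < e / 2"
    using real_arch_invD[of "e/2"] e by (auto simp: inverse_eq_divide)
  let ?A = "\<lambda>i. {x \<in> space \<mu>. real i / real m < f x}"
  have bounds: "(\<Sum>i\<in>{1..m}. measure \<nu> (?A i)) / real m \<le> (\<integral>x. f x \<partial>\<nu>)"
    "(\<integral>x. f x \<partial>\<nu>) \<le> (\<Sum>i\<in>{1..m}. measure \<nu> (?A i)) / real m + 1 / real m"
    if "prob_space \<nu>" "sets \<nu> = sets \<mu>" for \<nu>
  proof -
    interpret prob_space \<nu> by fact
    have sp: "space \<nu> = space \<mu>" using that(2) by (rule sets_eq_imp_space_eq)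
    have fm[measurable]: "f \<in> borel_measurable \<nu>" using f measurable_cong_sets[OF that(2) refl] by blast
    have int: "integrable \<nu> f" by (rule integrable_const_bound[of _ 1]) (use f01 in auto)
    have Am: "?A i \<in> sets \<nu>" for i unfolding sp[symmetric] by measurable
    have ind: "indicator {real i / real m<..} (f x) = (indicator (?A i) x :: real)" if "x \<in> space \<nu>" for i x
      using that sp by (auto simp: indicator_def)
    have eq: "(\<integral>x. (\<Sum>i\<in>{1..m}. indicator {real i / real m<..} (f x)) / real m \<partial>\<nu>) = (\<Sum>i\<in>{1..m}. measure \<nu> (?A i)) / real m"
      (is "(\<integral>x. ?s x \<partial>\<nu>) = _")
    proof -
      have "(\<integral>x. ?s x \<partial>\<nu>) = (\<integral>x. (\<Sum>i\<in>{1..m}. indicator (?A i) x) / real m \<partial>\<nu>)"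
        by (intro Bochner_Integration.integral_cong) (auto simp: ind)
      also have "\<dots> = (\<Sum>i\<in>{1..m}. \<integral>x. indicator (?A i) x \<partial>\<nu>) / real m"
        using Am by (subst integral_divide_zero, subst Bochner_Integration.integral_sum) (auto intro!: integrable_real_indicator simp: less_top[symmetric])
      also have "\<dots> = (\<Sum>i\<in>{1..m}. measure \<nu> (?A i)) / real m" using Am by simp
      finally show ?thesis .
    qed
    have ints: "integrable \<nu> ?s"
    proof (rule integrable_const_bound[of _ 1])
      have "0 \<le> ?s x" "?s x \<le> 1" for x
        using layer_sum_bounds(1)[OF m(1), of "f x"] f01[of x] by (auto intro!: divide_nonneg_nonneg sum_nonneg)
      then show "AE x in \<nu>. norm (?s x) \<le> 1" by (intro AE_I2) (simp only: real_norm_def abs_of_nonneg)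
    qed measurable
    have "(\<integral>x. ?s x \<partial>\<nu>) \<le> (\<integral>x. f x \<partial>\<nu>)"
      by (intro integral_mono ints int layer_sum_bounds m) (use f01 in auto)
    moreover have "(\<integral>x. f x \<partial>\<nu>) \<le> (\<integral>x. ?s x + 1 / real m \<partial>\<nu>)"
      by (intro integral_mono Bochner_Integration.integrable_add ints int layer_sum_bounds m) (use f01 in auto)
    ultimately show "(\<Sum>i\<in>{1..m}. measure \<nu> (?A i)) / real m \<le> (\<integral>x. f x \<partial>\<nu>)"
      "(\<integral>x. f x \<partial>\<nu>) \<le> (\<Sum>i\<in>{1..m}. measure \<nu> (?A i)) / real m + 1 / real m"
      using eq ints by (auto simp: prob_space)
  qed
  have "\<forall>\<^sub>F n in sequentially. \<forall>i\<in>{1..m}. measure (\<mu>s n) (?A i) > measure \<mu> (?A i) - e / 2"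
    using e by (intro eventually_ball_finite ballI lower) auto
  then show ?thesis
  proof eventually_elim
    case (elim n)
    have "(\<Sum>i\<in>{1..m}. measure \<mu> (?A i)) \<le> (\<Sum>i\<in>{1..m}. measure (\<mu>s n) (?A i) + e / 2)"
      by (intro sum_mono) (use bspec[OF elim] in \<open>simp add: diff_less_eq less_imp_le\<close>)
    also have "\<dots> = (\<Sum>i\<in>{1..m}. measure (\<mu>s n) (?A i)) + real m * (e / 2)"
      by (simp add: sum.distrib)
    finally have "(\<Sum>i\<in>{1..m}. measure \<mu> (?A i)) / real m \<le> (\<Sum>i\<in>{1..m}. measure (\<mu>s n) (?A i)) / real m + e / 2"
      using m by (simp add: field_simps)
    then show ?case
      using bounds(1)[OF fin(1) sets, of n] bounds(2)[OF fin(2) refl] m(2) by linarith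
  qed
qed

text \<open>Two lower bounds make a limit: the one-sided estimate is applied to \<open>f\<close> and
  to \<open>- f\<close>, both moved into [0, 1] by an affine map. That map divides differences by 2
  b, whence the choice of \<open>e'\<close>.\<close>

lemma integral_tendsto_of_pi_system:
  fixes \<mu>s :: "nat \<Rightarrow> 'x::topological_space measure" and \<mu> :: "'x measure" and f :: "'x \<Rightarrow> real"
  assumes prob: "\<And>n. prob_space (\<mu>s n)" "prob_space \<mu>"
    and sets: "\<And>n. sets (\<mu>s n) = sets borel" "sets \<mu> = sets borel"
    and A: "\<A> \<subseteq> sets borel" "\<And>A B. A \<in> \<A> \<Longrightarrow> B \<in> \<A> \<Longrightarrow> A \<inter> B \<in> \<A>" "countable \<A>"
    and lim: "\<And>A. A \<in> \<A> \<Longrightarrow> (\<lambda>n. measure (\<mu>s n) A) \<longlonglongrightarrow> measure \<mu> A"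
    and base: "\<And>G x. open G \<Longrightarrow> x \<in> G \<Longrightarrow> \<exists>A\<in>\<A>. x \<in> A \<and> A \<subseteq> G"
    and f: "continuous_on UNIV f" "bounded (range f)"
  shows "(\<lambda>n. \<integral>x. f x \<partial>\<mu>s n) \<longlonglongrightarrow> (\<integral>x. f x \<partial>\<mu>)"
proof -
  obtain b where b: "\<And>x. \<bar>f x\<bar> \<le> b" "b > 0"
    using f(2) by (auto simp: bounded_pos)
  have sp: "space \<mu> = UNIV" using sets_eq_imp_space_eq[OF sets(2)] by simp
  have low: "\<forall>\<^sub>F n in sequentially. (\<integral>x. g x \<partial>\<mu>s n) > (\<integral>x. g x \<partial>\<mu>) - e"
    if g: "continuous_on UNIV g" "\<And>x. 0 \<le> g x \<and> g x \<le> 1" and e: "e > 0" for g :: "'x \<Rightarrow> real" and e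
  proof (rule integral_eventually_lower[OF prob _ _ g(2) _ e])
    show "sets (\<mu>s n) = sets \<mu>" for n using sets by simp
    show "g \<in> borel_measurable \<mu>"
      using borel_measurable_continuous_onI[OF g(1)] measurable_cong_sets[OF sets(2) refl] by blast
    fix e c :: real assume e: "e > 0"
    have "open {x. c < g x}"
      using g(1) by (intro open_Collect_less continuous_intros) auto
    then have G: "{x. c < g x} = \<Union>{A \<in> \<A>. A \<subseteq> {x. c < g x}}"
      using base by (intro set_eqI iffI) (blast+)
    show "\<forall>\<^sub>F n in sequentially. measure (\<mu>s n) {x \<in> space \<mu>. c < g x} > measure \<mu> {x \<in> space \<mu>. c < g x} - e"
      unfolding sp using measure_tendsto_open_lower[OF _ _ _ _ A(2,3) lim G e] prob sets A(1)
      by (simp add: prob_space_def)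
  qed
  have int: "integrable \<nu> f" if "prob_space \<nu>" "sets \<nu> = sets borel" for \<nu>
  proof -
    interpret prob_space \<nu> by fact
    show ?thesis
      by (rule integrable_const_bound[of _ b])
        (use b borel_measurable_continuous_onI[OF f(1)] measurable_cong_sets[OF that(2) refl] in auto)
  qed
  have resc: "(\<integral>x. (b + f x) / (2 * b) \<partial>\<nu>) = (b + (\<integral>x. f x \<partial>\<nu>)) / (2 * b)"
     "(\<integral>x. (b - f x) / (2 * b) \<partial>\<nu>) = (b - (\<integral>x. f x \<partial>\<nu>)) / (2 * b)"
    if "prob_space \<nu>" "sets \<nu> = sets borel" for \<nu>
  proof -
    interpret prob_space \<nu> by fact
    show "(\<integral>x. (b + f x) / (2 * b) \<partial>\<nu>) = (b + (\<integral>x. f x \<partial>\<nu>)) / (2 * b)"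
     "(\<integral>x. (b - f x) / (2 * b) \<partial>\<nu>) = (b - (\<integral>x. f x \<partial>\<nu>)) / (2 * b)"
      using int[OF that] by (simp_all add: prob_space)
  qed
  have fb: "- b \<le> f x" "f x \<le> b" for x using b(1)[of x] by (auto simp: abs_le_iff)
  have fb': "0 \<le> (b + f x) / (2 * b)" "(b + f x) / (2 * b) \<le> 1" "0 \<le> (b - f x) / (2 * b)" "(b - f x) / (2 * b) \<le> 1" for x
    using fb[of x] b(2) by (auto simp: divide_simps)
  show ?thesis
  proof (unfold tendsto_iff dist_real_def, intro allI impI)
    fix e :: real assume e: "e > 0"
    define e' where "e' = e / (2 * b)"
    have e': "e' > 0" using e b by (simp add: e'_def)
    have "\<forall>\<^sub>F n in sequentially. (\<integral>x. (b + f x) / (2 * b) \<partial>\<mu>s n) > (\<integral>x. (b + f x) / (2 * b) \<partial>\<mu>) - e'"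
      by (rule low) (use b(2) f(1) e' in \<open>auto intro!: continuous_intros fb' e' simp: fb'\<close>)
    moreover have "\<forall>\<^sub>F n in sequentially. (\<integral>x. (b - f x) / (2 * b) \<partial>\<mu>s n) > (\<integral>x. (b - f x) / (2 * b) \<partial>\<mu>) - e'"
      by (rule low) (use b(2) f(1) e' in \<open>auto intro!: continuous_intros fb' e' simp: fb'\<close>)
    ultimately show "\<forall>\<^sub>F n in sequentially. \<bar>(\<integral>x. f x \<partial>\<mu>s n) - (\<integral>x. f x \<partial>\<mu>)\<bar> < e"
    proof eventually_elim
      case (elim n)
      then show ?case
        using b(2) unfolding resc[OF prob(1) sets(1)] resc[OF prob(2) sets(2)] e'_def
        by (simp add: diff_less_eq less_divide_eq divide_less_eq add_divide_distrib[symmetric] diff_divide_distrib[symmetric])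
    qed
  qed
qed

text \<open>Negated constraints are removed one at a time: imposing \<open>\<not> S j\<close>
  subtracts the measure of the set where \<open>S j\<close> is imposed instead. So \<open>K\<close>
  grows while \<open>J\<close> shrinks, and the induction generalizes over \<open>K\<close>.\<close>

lemma measure_tendsto_Int_Diff:
  fixes \<mu>s :: "nat \<Rightarrow> 'x measure" and \<mu> :: "'x measure"
  assumes fin: "\<And>n. finite_measure (\<mu>s n)" "finite_measure \<mu>"
    and sets: "\<And>n. sets (\<mu>s n) = sets \<mu>"
    and S: "\<And>i. i \<in> I \<Longrightarrow> {x \<in> space \<mu>. S i x} \<in> sets \<mu>"
    and lim: "\<And>K. finite K \<Longrightarrow> K \<subseteq> I \<Longrightarrow>
       (\<lambda>n. measure (\<mu>s n) {x \<in> space \<mu>. \<forall>i\<in>K. S i x}) \<longlonglongrightarrow> measure \<mu> {x \<in> space \<mu>. \<forall>i\<in>K. S i x}"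
    and J: "finite J" "J \<subseteq> I" and K: "finite K" "K \<subseteq> I"
  shows "(\<lambda>n. measure (\<mu>s n) {x \<in> space \<mu>. (\<forall>i\<in>K. S i x) \<and> (\<forall>i\<in>J. \<not> S i x)})
     \<longlonglongrightarrow> measure \<mu> {x \<in> space \<mu>. (\<forall>i\<in>K. S i x) \<and> (\<forall>i\<in>J. \<not> S i x)}"
  using J K
proof (induction J arbitrary: K rule: finite_induct)
  case empty
  then show ?case using lim[of K] by simp
next
  case (insert j J)
  have meas: "{x \<in> space \<mu>. (\<forall>i\<in>K. S i x) \<and> (\<forall>i\<in>J. \<not> S i x)} \<in> sets \<mu>"
    if "finite K" "K \<subseteq> I" for K
  proof -
    have "{x \<in> space \<mu>. \<not> S i x} \<in> sets \<mu>" if "i \<in> I" for i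
    proof -
      have "{x \<in> space \<mu>. \<not> S i x} = space \<mu> - {x \<in> space \<mu>. S i x}" by auto
      then show ?thesis using S[OF that] by simp
    qed
    then have "{x \<in> space \<mu>. \<forall>i\<in>K. S i x} \<in> sets \<mu>" "{x \<in> space \<mu>. \<forall>i\<in>J. \<not> S i x} \<in> sets \<mu>"
      using that insert.prems(1) insert.hyps(1) S by (intro sets.sets_Collect_finite_All; blast)+
    then have "{x \<in> space \<mu>. \<forall>i\<in>K. S i x} \<inter> {x \<in> space \<mu>. \<forall>i\<in>J. \<not> S i x} \<in> sets \<mu>" by (rule sets.Int)
    then show ?thesis by (rule back_subst[where P="\<lambda>A. A \<in> sets \<mu>"]) auto
  qed
  have split: "measure \<nu> {x \<in> space \<mu>. (\<forall>i\<in>K. S i x) \<and> (\<forall>i\<in>insert j J. \<not> S i x)} =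
      measure \<nu> {x \<in> space \<mu>. (\<forall>i\<in>K. S i x) \<and> (\<forall>i\<in>J. \<not> S i x)} -
      measure \<nu> {x \<in> space \<mu>. (\<forall>i\<in>insert j K. S i x) \<and> (\<forall>i\<in>J. \<not> S i x)}"
    if "finite_measure \<nu>" "sets \<nu> = sets \<mu>" for \<nu>
  proof -
    interpret finite_measure \<nu> by fact
    have "{x \<in> space \<mu>. (\<forall>i\<in>K. S i x) \<and> (\<forall>i\<in>insert j J. \<not> S i x)} =
      {x \<in> space \<mu>. (\<forall>i\<in>K. S i x) \<and> (\<forall>i\<in>J. \<not> S i x)} -
      {x \<in> space \<mu>. (\<forall>i\<in>insert j K. S i x) \<and> (\<forall>i\<in>J. \<not> S i x)}" by auto
    then show ?thesis
      using meas[of K] meas[of "insert j K"] insert.prems that(2)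
      by (simp only:) (intro finite_measure_Diff, auto)
  qed
  show ?case
    unfolding split[OF fin(1) sets] split[OF fin(2) refl]
    using insert.prems by (intro tendsto_diff insert.IH) auto
qed

section \<open>Boxes in the sequence space\<close>

text \<open>A basic open set restricts finitely many coordinates; in each of them a half-open
  interval with end points in \<open>D\<close> fits around the point. The strict lower ends are
  written as negations of \<open>x j \<le> r\<close>, so that distribution functions alone determine
  the measures of these boxes.\<close>

lemma cylinder_base:
  fixes G :: "(nat \<Rightarrow> real) set"
  assumes D: "\<And>a b. a < b \<Longrightarrow> \<exists>d\<in>D. a < d \<and> d < b"
    and G: "open G" "x \<in> G"
  shows "\<exists>K J. finite K \<and> finite J \<and> K \<subseteq> UNIV \<times> D \<and> J \<subseteq> UNIV \<times> D \<and>
     x \<in> {x. (\<forall>(j,r)\<in>K. x j \<le> r) \<and> (\<forall>(j,r)\<in>J. \<not> x j \<le> r)} \<and>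
     {x. (\<forall>(j,r)\<in>K. x j \<le> r) \<and> (\<forall>(j,r)\<in>J. \<not> x j \<le> r)} \<subseteq> G"
proof -
  obtain X where X: "x \<in> Pi\<^sub>E UNIV X" "\<And>i. open (X i)" "finite {i. X i \<noteq> UNIV}" "Pi\<^sub>E UNIV X \<subseteq> G"
    using product_topology_open_contains_basis[of "\<lambda>_. euclidean" UNIV G x] G
    unfolding open_fun_def by auto
  have "\<exists>l\<in>D. \<exists>r\<in>D. l < x i \<and> x i \<le> r \<and> {l<..r} \<subseteq> X i" for i
  proof -
    have "x i \<in> X i" using X(1) by auto
    then obtain e where e: "e > 0" "\<And>y. dist y (x i) < e \<Longrightarrow> y \<in> X i"
      using X(2) unfolding open_dist by blast
    obtain l where "l \<in> D" "x i - e < l" "l < x i" using D[of "x i - e" "x i"] e(1) by auto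
    moreover obtain r where "r \<in> D" "x i < r" "r < x i + e" using D[of "x i" "x i + e"] e(1) by auto
    ultimately show ?thesis
      by (intro bexI[of _ l] bexI[of _ r]) (auto intro!: e(2) simp: dist_real_def)
  qed
  then obtain l r where lr: "\<And>i. l i \<in> D" "\<And>i. r i \<in> D" "\<And>i. l i < x i" "\<And>i. x i \<le> r i" "\<And>i. {l i<..r i} \<subseteq> X i"
    by metis
  let ?K = "(\<lambda>i. (i, r i)) ` {i. X i \<noteq> UNIV}" and ?J = "(\<lambda>i. (i, l i)) ` {i. X i \<noteq> UNIV}"
  show ?thesis
  proof (rule exI[of _ ?K], rule exI[of _ ?J], intro conjI)
    show "x \<in> {x. (\<forall>(j, r)\<in>?K. x j \<le> r) \<and> (\<forall>(j, r)\<in>?J. \<not> x j \<le> r)}"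
      using lr(3,4) by (auto simp: not_le)
    show "{x. (\<forall>(j, r)\<in>?K. x j \<le> r) \<and> (\<forall>(j, r)\<in>?J. \<not> x j \<le> r)} \<subseteq> G"
    proof
      fix y assume "y \<in> {x. (\<forall>(j, r)\<in>?K. x j \<le> r) \<and> (\<forall>(j, r)\<in>?J. \<not> x j \<le> r)}"
      then have "y i \<in> X i" for i
        using lr(5)[of i] by (cases "X i = UNIV") (auto simp: subset_iff not_le)
      then show "y \<in> G" using X(4) by auto
    qed
  qed (use X(3) lr in auto)
qed

lemma orthant_sets: "{x::nat \<Rightarrow> real. \<forall>(j, r)\<in>K. x j \<le> r} \<in> sets borel"
proof -
  have "{x::nat \<Rightarrow> real. \<forall>(j, r)\<in>K. x j \<le> r} = (\<Inter>p\<in>K. {x. x (fst p) \<le> snd p})" by (simp add: case_prod_beta' set_eq_iff)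
  moreover have "closed (\<Inter>p\<in>K. {x. x (fst p) \<le> (snd p :: real)})"
    by (intro closed_INT ballI closed_Collect_le continuous_intros) (auto intro: continuous_on_product_coordinates)
  ultimately show ?thesis by (simp add: borel_closed)
qed

text \<open>The set \<open>D\<close> carries the flexibility: it has to be countable and dense only,
  so thresholds at which the limit has mass can be left out. The boxes built from it form a
  countable base closed under intersection.\<close>

lemma weak_conv_on_of_orthants:
  fixes \<mu>s :: "nat \<Rightarrow> (nat \<Rightarrow> real) measure" and \<mu> :: "(nat \<Rightarrow> real) measure"
  assumes prob: "\<And>n. prob_space (\<mu>s n)" "prob_space \<mu>"
    and sets: "\<And>n. sets (\<mu>s n) = sets borel" "sets \<mu> = sets borel"
    and D: "countable D" "\<And>a b. a < b \<Longrightarrow> \<exists>d\<in>D. a < d \<and> d < b"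
    and lim: "\<And>K. finite K \<Longrightarrow> K \<subseteq> UNIV \<times> D \<Longrightarrow>
      (\<lambda>n. measure (\<mu>s n) {x. \<forall>(j,r)\<in>K. x j \<le> r}) \<longlonglongrightarrow> measure \<mu> {x. \<forall>(j,r)\<in>K. x j \<le> r}"
  shows "weak_conv_on UNIV \<mu>s \<mu>"
  unfolding weak_conv_on_def
proof (intro allI impI, elim conjE)
  fix f :: "(nat \<Rightarrow> real) \<Rightarrow> real"
  assume f: "continuous_on UNIV f" "bounded (range f)"
  define C where "C = (\<lambda>(K,J). {x::nat \<Rightarrow> real. (\<forall>(j,r)\<in>K. x j \<le> r) \<and> (\<forall>(j,r)\<in>J. \<not> x j \<le> r)})"
  define F where "F = {K. finite K \<and> K \<subseteq> (UNIV::nat set) \<times> D}"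
  have cF: "countable F"
    unfolding F_def using D(1) by (intro countable_Collect_finite_subset) auto
  have sp: "space \<mu> = UNIV" using sets_eq_imp_space_eq[OF sets(2)] by simp
  have S: "{x::nat \<Rightarrow> real. x j \<le> r} \<in> sets borel" for j r
    using orthant_sets[of "{(j, r)}"] by simp
  show "(\<lambda>n. \<integral>x. f x \<partial>\<mu>s n) \<longlonglongrightarrow> (\<integral>x. f x \<partial>\<mu>)"
  proof (rule integral_tendsto_of_pi_system[OF prob sets _ _ _ _ _ f])
    show "countable (C ` (F \<times> F))" using cF by auto
    show "A \<inter> B \<in> C ` (F \<times> F)" if AB: "A \<in> C ` (F \<times> F)" "B \<in> C ` (F \<times> F)" for A B
    proof -
      obtain K J K' J' where "K \<in> F" "J \<in> F" "A = C (K, J)" "K' \<in> F" "J' \<in> F" "B = C (K', J')"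
        using AB by auto
      then show ?thesis
        by (intro image_eqI[of _ _ "(K \<union> K', J \<union> J')"]) (auto simp: C_def F_def)
    qed
    show "C ` (F \<times> F) \<subseteq> sets borel"
    proof
      fix A assume "A \<in> C ` (F \<times> F)"
      then obtain K J where KJ: "K \<in> F" "J \<in> F" "A = C (K, J)" by auto
      have "A = (\<Inter>p\<in>K. {x. x (fst p) \<le> snd p}) \<inter> (\<Inter>p\<in>J. - {x. x (fst p) \<le> snd p})"
        unfolding KJ C_def by (simp add: case_prod_beta' set_eq_iff)
      also have "\<dots> \<in> sets borel"
      proof (intro sets.Int)
        show "(\<Inter>p\<in>K. {x. x (fst p) \<le> snd p}) \<in> sets (borel :: (nat \<Rightarrow> real) measure)"
          using KJ S by (cases "K = {}") (auto simp: F_def intro!: sets.finite_INT)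
        have "- {x. x j \<le> r} \<in> sets (borel :: (nat \<Rightarrow> real) measure)" for j r
          using S[of j r] by (simp only: Compl_eq_Diff_UNIV borel_comp sets.Diff) auto
        then show "(\<Inter>p\<in>J. - {x. x (fst p) \<le> snd p}) \<in> sets (borel :: (nat \<Rightarrow> real) measure)"
          using KJ by (cases "J = {}") (auto simp: F_def intro!: sets.finite_INT)
      qed
      finally show "A \<in> sets borel" .
    qed
    show "(\<lambda>n. measure (\<mu>s n) A) \<longlonglongrightarrow> measure \<mu> A" if A: "A \<in> C ` (F \<times> F)" for A
    proof -
      obtain K J where KJ: "K \<in> F" "J \<in> F" "A = C (K, J)" using A by auto
      have "(\<lambda>n. measure (\<mu>s n) {x \<in> space \<mu>. (\<forall>i\<in>K. x (fst i) \<le> snd i) \<and> (\<forall>i\<in>J. \<not> x (fst i) \<le> snd i)})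
        \<longlonglongrightarrow> measure \<mu> {x \<in> space \<mu>. (\<forall>i\<in>K. x (fst i) \<le> snd i) \<and> (\<forall>i\<in>J. \<not> x (fst i) \<le> snd i)}"
        by (rule measure_tendsto_Int_Diff[where I="UNIV \<times> D"])
          (use KJ lim prob S sets sp in \<open>auto simp: F_def prob_space_def case_prod_beta'\<close>)
      then show ?thesis unfolding KJ C_def sp by (simp add: case_prod_beta')
    qed
    show "\<exists>A\<in>C ` (F \<times> F). x \<in> A \<and> A \<subseteq> G" if G: "open G" "x \<in> G" for G x
    proof -
      obtain K J where "finite K" "finite J" "K \<subseteq> UNIV \<times> D" "J \<subseteq> UNIV \<times> D" "x \<in> C (K, J)" "C (K, J) \<subseteq> G"
        using cylinder_base[OF D(2) G] unfolding C_def by auto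
      then show ?thesis by (intro bexI[of _ "C (K, J)"]) (auto simp: F_def)
    qed
  qed
qed

subsection \<open>Exceedances of the spectral points\<close>

lemma emeasure_frechet_intensity:
  assumes "0 < x"
  shows "emeasure frechet_intensity {x<..} = ennreal (1 / x)"
proof -
  have "emeasure frechet_intensity {x<..} = (\<integral>\<^sup>+u. ennreal (indicator {0<..} u / u\<^sup>2) * indicator {x<..} u \<partial>lborel)"
    unfolding frechet_intensity_def by (subst emeasure_density) auto
  \<comment> \<open>Adding the null point \<open>x\<close> produces the closed half-line that
    \<open>nn_integral_FTC_atLeast\<close> asks for.\<close>
  also have "\<dots> = (\<integral>\<^sup>+u. ennreal (1 / u\<^sup>2) * indicator {x..} u \<partial>lborel)"
    using AE_lborel_singleton[of x] assms by (intro nn_integral_cong_AE) (auto split: split_indicator)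
  also have "\<dots> = ennreal (0 - (- 1 / x))"
  proof (rule nn_integral_FTC_atLeast)
    show "((\<lambda>u::real. - 1 / u) has_real_derivative 1 / y\<^sup>2) (at y)" if "x \<le> y" for y
      using that assms by (auto intro!: derivative_eq_intros simp: power2_eq_square)
    show "((\<lambda>u::real. - 1 / u) \<longlongrightarrow> 0) at_top" by real_asymp
  qed auto
  finally show ?thesis by simp
qed

lemma nn_integral_of_nat_poisson:
  fixes N :: "'a \<Rightarrow> nat"
  assumes "prob_space P" and N: "N \<in> measurable P (count_space UNIV)" and l: "0 \<le> l"
    and law: "\<And>n. measure P {\<omega> \<in> space P. N \<omega> = n} = exp (- l) * l ^ n / fact n"
  shows "(\<integral>\<^sup>+\<omega>. of_nat (N \<omega>) \<partial>P) = ennreal l"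
proof -
  interpret prob_space P by fact
  have "(\<integral>\<^sup>+\<omega>. of_nat (N \<omega>) \<partial>P) = (\<integral>\<^sup>+\<omega>. (\<Sum>n. ennreal (real n) * indicator {\<omega> \<in> space P. N \<omega> = n} \<omega>) \<partial>P)"
  proof (rule nn_integral_cong)
    fix \<omega> assume "\<omega> \<in> space P"
    then have "(\<lambda>n. ennreal (real n) * indicator {\<omega> \<in> space P. N \<omega> = n} \<omega>) = (\<lambda>n. if n = N \<omega> then of_nat n else 0)"
      by (auto simp: ennreal_of_nat_eq_real_of_nat)
    then show "of_nat (N \<omega>) = (\<Sum>n. ennreal (real n) * indicator {\<omega> \<in> space P. N \<omega> = n} \<omega>)"
      using suminf_finite[of "{N \<omega>}" "\<lambda>n. if n = N \<omega> then of_nat n else 0 :: ennreal"] by simp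
  qed
  also have "\<dots> = (\<Sum>n. ennreal (real n) * emeasure P {\<omega> \<in> space P. N \<omega> = n})"
    using N by (subst nn_integral_suminf) (auto simp: nn_integral_cmult_indicator)
  also have "\<dots> = (\<Sum>n. ennreal (real n * (exp (- l) * l ^ n / fact n)))"
    using l by (intro suminf_cong) (simp add: emeasure_eq_measure law ennreal_mult[symmetric])
  also have "\<dots> = ennreal l"
  proof (rule suminf_ennreal_eq)
    have "(\<lambda>n. inverse (fact n) *\<^sub>R l ^ n) sums exp l" by (rule exp_converges)
    then have "(\<lambda>n. (l * exp (- l)) * (inverse (fact n) *\<^sub>R l ^ n)) sums ((l * exp (- l)) * exp l)"
      by (rule sums_mult)
    \<comment> \<open>The factor \<open>Suc n\<close> cancels against the factorial and leaves the
      exponential series; the term at 0 vanishes, so the index shift is free.\<close>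
    moreover have "real (Suc n) * (exp (- l) * l ^ Suc n / fact (Suc n)) = (l * exp (- l)) * (inverse (fact n) *\<^sub>R l ^ n)" for n
      by (simp add: divide_simps del: of_nat_Suc)
    ultimately have "(\<lambda>n. real (Suc n) * (exp (- l) * l ^ Suc n / fact (Suc n))) sums l"
      by (simp add: mult_exp_exp mult.assoc)
    then show "(\<lambda>n. real n * (exp (- l) * l ^ n / fact n)) sums l"
      by (subst (asm) sums_Suc_iff) simp
  qed (use l in auto)
  finally show ?thesis .
qed

section \<open>The Poisson points and their counts\<close>

locale spectral_points = prob_space P for P :: "'c measure" +
  fixes U :: "nat \<Rightarrow> 'c \<Rightarrow> real" and Vs :: "nat \<Rightarrow> 'c \<Rightarrow> 't \<Rightarrow> real"
    and Q :: "'d measure" and V :: "'d \<Rightarrow> 't \<Rightarrow> real"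
  assumes Q: "prob_space Q"
    and V_meas[measurable]: "V \<in> measurable Q process_space"
    and U_ppp: "frechet_ppp P U"
    and Vs_meas[measurable]: "\<And>i. Vs i \<in> measurable P process_space"
    and Vs_law: "\<And>i. distr P process_space (Vs i) = distr Q process_space V"
    and U_Vs_indep: "indep_set
       (sets (vimage_algebra (space P) (\<lambda>\<omega> i. U i \<omega>) (PiM UNIV (\<lambda>_. borel))))
       (sets (vimage_algebra (space P) (\<lambda>\<omega> i. Vs i \<omega>) (PiM UNIV (\<lambda>_. process_space))))"
begin

lemma U_meas[measurable]: "U i \<in> borel_measurable P"
  using U_ppp unfolding frechet_ppp_def by auto

lemma U_pos: "AE \<omega> in P. \<forall>i. 0 < U i \<omega>"
  using U_ppp unfolding frechet_ppp_def by auto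

text \<open>\<open>card\<close> of an infinite set is 0, so for \<open>x > 0\<close> this is the
  true count only almost surely.\<close>

definition exceed_count :: "real \<Rightarrow> 'c \<Rightarrow> nat" where
  "exceed_count x \<omega> = card {i. x < U i \<omega>}"

lemma exceed_count_finite:
  assumes "0 < x"
  shows "AE \<omega> in P. finite {i. x < U i \<omega>}"
    and "measure P {\<omega> \<in> space P. exceed_count x \<omega> = n} = exp (- (1 / x)) * (1 / x) ^ n / fact n"
proof -
  have "emeasure frechet_intensity {x<..} < \<infinity>" "measure frechet_intensity {x<..} = 1 / x"
    using assms by (auto simp: emeasure_frechet_intensity measure_def)
  then have "(AE \<omega> in P. finite {i. U i \<omega> \<in> {x<..}}) \<and> (\<forall>n::nat. measure P {\<omega> \<in> space P. card {i. U i \<omega> \<in> {x<..}} = n} =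
            exp (- (1 / x)) * (1 / x) ^ n / fact n)"
    using U_ppp[unfolded frechet_ppp_def, THEN conjunct2, THEN conjunct2, THEN conjunct1, rule_format, of "{x<..}"] assms
    by auto
  then show "AE \<omega> in P. finite {i. x < U i \<omega>}"
     "measure P {\<omega> \<in> space P. exceed_count x \<omega> = n} = exp (- (1 / x)) * (1 / x) ^ n / fact n"
    by (auto simp: exceed_count_def)
qed

text \<open>Finiteness of a set of indices is boundedness, a countable condition, and a finite
  cardinality is a series of indicators. The default 0 agrees with \<open>card\<close> of an
  infinite set.\<close>

lemma exceed_count_measurable[measurable]: "exceed_count x \<in> measurable P (count_space UNIV)"
proof -
  have "exceed_count x = (\<lambda>\<omega>. if \<exists>m. \<forall>i. x < U i \<omega> \<longrightarrow> i < m
     then nat \<lfloor>suminf (\<lambda>i. indicator {i. x < U i \<omega>} i :: real)\<rfloor> else 0)"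
  proof
    fix \<omega>
    show "exceed_count x \<omega> = (if \<exists>m. \<forall>i. x < U i \<omega> \<longrightarrow> i < m
     then nat \<lfloor>suminf (\<lambda>i. indicator {i. x < U i \<omega>} i :: real)\<rfloor> else 0)"
    proof (cases "finite {i. x < U i \<omega>}")
      case True
      then have "(\<Sum>i. indicator {i. x < U i \<omega>} i :: real) = (\<Sum>i\<in>{i. x < U i \<omega>}. indicator {i. x < U i \<omega>} i)"
        by (intro suminf_finite) auto
      then show ?thesis using True by (auto simp: exceed_count_def finite_nat_set_iff_bounded)
    next
      case False
      then show ?thesis by (auto simp: exceed_count_def finite_nat_set_iff_bounded)
    qed
  qed
  also have "\<dots> \<in> measurable P (count_space UNIV)"
    unfolding indicator_def by measurable
  finally show ?thesis .
qed

lemma exceed_count_sum: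
  "finite {i. x < U i \<omega>} \<Longrightarrow> (\<Sum>i. indicator {x<..} (U i \<omega>)) = (of_nat (exceed_count x \<omega>) :: ennreal)"
  using suminf_finite[of "{i. x < U i \<omega>}" "\<lambda>i. indicator {x<..} (U i \<omega>) :: ennreal"]
  by (auto simp: exceed_count_def)

lemma nn_integral_exceed_count:
  assumes "0 < x"
  shows "(\<integral>\<^sup>+\<omega>. of_nat (exceed_count x \<omega>) \<partial>P) = ennreal (1 / x)"
  using assms exceed_count_finite(2)[OF assms]
  by (intro nn_integral_of_nat_poisson prob_space_axioms) auto

text \<open>The laws of the individual \<open>U i\<close> are unknown, but their tails add up to the
  mean of the Poisson count.\<close>

lemma sum_U_tail:
  assumes "0 < x"
  shows "(\<Sum>i. emeasure P {\<omega> \<in> space P. x < U i \<omega>}) = ennreal (1 / x)"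
proof -
  have "(\<Sum>i. emeasure P {\<omega> \<in> space P. x < U i \<omega>}) = (\<Sum>i. \<integral>\<^sup>+\<omega>. indicator {x<..} (U i \<omega>) \<partial>P)"
  proof (intro suminf_cong)
    fix i
    have "(\<integral>\<^sup>+\<omega>. indicator {x<..} (U i \<omega>) \<partial>P) = (\<integral>\<^sup>+\<omega>. indicator {\<omega> \<in> space P. x < U i \<omega>} \<omega> \<partial>P)"
      by (intro nn_integral_cong) (auto split: split_indicator)
    then show "emeasure P {\<omega> \<in> space P. x < U i \<omega>} = (\<integral>\<^sup>+\<omega>. indicator {x<..} (U i \<omega>) \<partial>P)" by simp
  qed
  also have "\<dots> = (\<integral>\<^sup>+\<omega>. (\<Sum>i. indicator {x<..} (U i \<omega>)) \<partial>P)"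
    by (intro nn_integral_suminf[symmetric]) auto
  also have "\<dots> = (\<integral>\<^sup>+\<omega>. of_nat (exceed_count x \<omega>) \<partial>P)"
    using exceed_count_finite(1)[OF assms]
    by (intro nn_integral_cong_AE) (auto elim!: eventually_mono simp: exceed_count_sum)
  finally show ?thesis using nn_integral_exceed_count[OF assms] by simp
qed

text \<open>The algebras generated by \<open>U i\<close> and by \<open>g (Vs i)\<close> lie inside
  those of the two whole sequences, which are independent by assumption.\<close>

lemma indep_U_Vs:
  assumes [measurable]: "g \<in> borel_measurable process_space"
  shows "indep_var borel (U i) borel (\<lambda>\<omega>. g (Vs i \<omega>))"
  unfolding indep_var_eq
proof (intro conjI)
  have 1: "sigma_sets (space P) {U i -` A \<inter> space P |A. A \<in> sets borel} \<subseteq>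
     sets (vimage_algebra (space P) (\<lambda>\<omega> i. U i \<omega>) (PiM UNIV (\<lambda>_. borel)))" (is "_ \<subseteq> sets ?F")
  proof -
    have "{U i -` A \<inter> space P |A. A \<in> sets borel} \<subseteq> sets ?F"
    proof safe
      fix A :: "real set" assume [measurable]: "A \<in> sets borel"
      have "(\<lambda>\<omega> i. U i \<omega>) -` {f \<in> space (PiM UNIV (\<lambda>_. borel)). f i \<in> A} \<inter> space P \<in> sets ?F"
        by (intro in_vimage_algebra) measurable
      also have "(\<lambda>\<omega> i. U i \<omega>) -` {f \<in> space (PiM UNIV (\<lambda>_. borel)). f i \<in> A} \<inter> space P = U i -` A \<inter> space P"
        by (auto simp: space_PiM)
      finally show "U i -` A \<inter> space P \<in> sets ?F" .
    qed
    then show ?thesis using sets.sigma_sets_subset[of _ ?F] by simp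
  qed
  have 2: "sigma_sets (space P) {(\<lambda>\<omega>. g (Vs i \<omega>)) -` A \<inter> space P |A. A \<in> sets borel} \<subseteq>
     sets (vimage_algebra (space P) (\<lambda>\<omega> i. Vs i \<omega>) (PiM UNIV (\<lambda>_. process_space)))" (is "_ \<subseteq> sets ?F")
  proof -
    have "{(\<lambda>\<omega>. g (Vs i \<omega>)) -` A \<inter> space P |A. A \<in> sets borel} \<subseteq> sets ?F"
    proof safe
      fix A :: "real set" assume [measurable]: "A \<in> sets borel"
      have "(\<lambda>\<omega> i. Vs i \<omega>) -` {f \<in> space (PiM UNIV (\<lambda>_. process_space)). g (f i) \<in> A} \<inter> space P \<in> sets ?F"
        by (intro in_vimage_algebra) measurable
      also have "(\<lambda>\<omega> i. Vs i \<omega>) -` {f \<in> space (PiM UNIV (\<lambda>_. process_space)). g (f i) \<in> A} \<inter> space P = (\<lambda>\<omega>. g (Vs i \<omega>)) -` A \<inter> space P"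
        using measurable_space[OF Vs_meas] by (auto simp: space_PiM)
      finally show "(\<lambda>\<omega>. g (Vs i \<omega>)) -` A \<inter> space P \<in> sets ?F" .
    qed
    then show ?thesis using sets.sigma_sets_subset[of _ ?F] by simp
  qed
  show "indep_set (sigma_sets (space P) {U i -` A \<inter> space P |A. A \<in> sets borel})
     (sigma_sets (space P) {(\<lambda>\<omega>. g (Vs i \<omega>)) -` A \<inter> space P |A. A \<in> sets borel})"
    using U_Vs_indep 1 2 unfolding indep_set_def
    by (rule_tac indep_sets_mono_sets) (auto split: bool.split)
qed measurable

lemma distr_Vs:
  assumes [measurable]: "g \<in> borel_measurable process_space"
  shows "distr P borel (\<lambda>\<omega>. g (Vs i \<omega>)) = distr Q borel (\<lambda>\<omega>. g (V \<omega>))"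
  using distr_distr[of g process_space borel "Vs i" P] distr_distr[of g process_space borel V Q] Vs_law[of i]
  by (simp add: comp_def)

section \<open>Campbell's formula and exceedance bounds\<close>

text \<open>Fubini for each index, integrating over the value w of \<open>g (Vs i)\<close>, whose
  law is the same for all \<open>i\<close>. The sum can then be moved inside, where for fixed w > 0
  the tails of \<open>U i\<close> at c / w add up to w / c.\<close>

lemma campbell:
  assumes g[measurable]: "g \<in> borel_measurable process_space" and nonneg: "\<And>\<omega>. \<omega> \<in> space Q \<Longrightarrow> 0 \<le> g (V \<omega>)"
    and c: "0 < c"
  shows "(\<Sum>i. emeasure P {\<omega> \<in> space P. c < U i \<omega> * g (Vs i \<omega>)}) = (\<integral>\<^sup>+\<omega>. ennreal (g (V \<omega>) / c) \<partial>Q)"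
proof -
  interpret Q: prob_space Q by (rule Q)
  let ?L = "distr Q borel (\<lambda>\<omega>. g (V \<omega>))"
  have 1: "emeasure P {\<omega> \<in> space P. c < U i \<omega> * g (Vs i \<omega>)} = (\<integral>\<^sup>+w. emeasure P {\<omega> \<in> space P. c < U i \<omega> * w} \<partial>?L)" for i
  proof -
    have D: "distr P borel (U i) \<Otimes>\<^sub>M ?L = distr P (borel \<Otimes>\<^sub>M borel) (\<lambda>\<omega>. (U i \<omega>, g (Vs i \<omega>)))"
      using indep_U_Vs[OF g, of i] unfolding indep_var_distribution_eq by (simp add: distr_Vs)
    interpret L: prob_space ?L by (intro Q.prob_space_distr) measurable
    interpret DU: prob_space "distr P borel (U i)" by (intro prob_space_distr) measurable
    interpret LU: pair_sigma_finite "distr P borel (U i)" ?L ..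
    have S: "{p \<in> space (borel \<Otimes>\<^sub>M borel). c < fst p * snd p} \<in> sets (borel \<Otimes>\<^sub>M borel :: (real \<times> real) measure)" by measurable
    have "emeasure P {\<omega> \<in> space P. c < U i \<omega> * g (Vs i \<omega>)} =
       emeasure (distr P (borel \<Otimes>\<^sub>M borel) (\<lambda>\<omega>. (U i \<omega>, g (Vs i \<omega>)))) {p \<in> space (borel \<Otimes>\<^sub>M borel). c < fst p * snd p}"
      by (subst emeasure_distr[OF _ S]) (auto intro!: arg_cong[where f="emeasure P"] simp: space_pair_measure)
    also have "\<dots> = (\<integral>\<^sup>+w. emeasure (distr P borel (U i)) ((\<lambda>u. (u, w)) -` {p \<in> space (borel \<Otimes>\<^sub>M borel). c < fst p * snd p}) \<partial>?L)"
      unfolding D[symmetric] by (intro LU.emeasure_pair_measure_alt2) (use S in simp)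
    also have "\<dots> = (\<integral>\<^sup>+w. emeasure P {\<omega> \<in> space P. c < U i \<omega> * w} \<partial>?L)"
      by (intro nn_integral_cong, subst emeasure_distr) (auto intro!: arg_cong[where f="emeasure P"] simp: space_pair_measure)
    finally show ?thesis .
  qed
  have m: "(\<lambda>w. emeasure P {\<omega> \<in> space P. c < U i \<omega> * w}) \<in> borel_measurable borel" for i
  proof -
    have S: "{p \<in> space (borel \<Otimes>\<^sub>M P). c < U i (snd p) * fst p} \<in> sets (borel \<Otimes>\<^sub>M P)" by measurable
    have "(\<lambda>w. emeasure P (Pair w -` {p \<in> space (borel \<Otimes>\<^sub>M P). c < U i (snd p) * fst p})) \<in> borel_measurable borel"
      using S by (rule measurable_emeasure_Pair)
    then show ?thesis by (simp add: space_pair_measure vimage_def)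
  qed
  have "(\<Sum>i. emeasure P {\<omega> \<in> space P. c < U i \<omega> * g (Vs i \<omega>)}) = (\<integral>\<^sup>+w. (\<Sum>i. emeasure P {\<omega> \<in> space P. c < U i \<omega> * w}) \<partial>?L)"
    unfolding 1 by (intro nn_integral_suminf[symmetric]) (use m in simp)
  also have "\<dots> = (\<integral>\<^sup>+\<omega>. (\<Sum>i. emeasure P {\<omega>' \<in> space P. c < U i \<omega>' * g (V \<omega>)}) \<partial>Q)"
    by (subst nn_integral_distr) (use m in auto)
  also have "\<dots> = (\<integral>\<^sup>+\<omega>. ennreal (g (V \<omega>) / c) \<partial>Q)"
  proof (rule nn_integral_cong)
    fix \<omega> assume "\<omega> \<in> space Q"
    then consider "g (V \<omega>) = 0" | "0 < g (V \<omega>)" using nonneg[of \<omega>] by force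
    then show "(\<Sum>i. emeasure P {\<omega>' \<in> space P. c < U i \<omega>' * g (V \<omega>)}) = ennreal (g (V \<omega>) / c)"
    proof cases
      case 1
      then show ?thesis using c by simp
    next
      case 2
      then have "c < u * g (V \<omega>) \<longleftrightarrow> c / g (V \<omega>) < u" for u by (simp add: field_simps)
      then show ?thesis using sum_U_tail[of "c / g (V \<omega>)"] 2 c by simp
    qed
  qed
  finally show ?thesis .
qed

lemma exceedance_upper:
  assumes g[measurable]: "g \<in> borel_measurable process_space" and nonneg: "\<And>\<omega>. \<omega> \<in> space Q \<Longrightarrow> 0 \<le> g (V \<omega>)"
    and int: "integrable Q (\<lambda>\<omega>. g (V \<omega>))" and c: "0 < c"
  shows "measure P {\<omega> \<in> space P. \<exists>i. c < U i \<omega> * g (Vs i \<omega>)} \<le> (\<integral>\<omega>. g (V \<omega>) \<partial>Q) / c"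
proof -
  have "{\<omega> \<in> space P. \<exists>i. c < U i \<omega> * g (Vs i \<omega>)} = (\<Union>i. {\<omega> \<in> space P. c < U i \<omega> * g (Vs i \<omega>)})" by auto
  then have "emeasure P {\<omega> \<in> space P. \<exists>i. c < U i \<omega> * g (Vs i \<omega>)} \<le> (\<Sum>i. emeasure P {\<omega> \<in> space P. c < U i \<omega> * g (Vs i \<omega>)})"
    by (auto intro!: emeasure_subadditive_countably)
  also have "\<dots> = ennreal ((\<integral>\<omega>. g (V \<omega>) \<partial>Q) / c)"
    using int nonneg c by (subst campbell[OF g nonneg c]) (simp_all add: nn_integral_eq_integral)
  finally show ?thesis
    using c nonneg by (auto simp: emeasure_eq_measure intro!: divide_nonneg_nonneg integral_nonneg_AE)
qed

text \<open>Let N count the points above c / b. All exceedances of the function truncated at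
  \<open>b\<close> come from such points, so their number is at most 1_E + (N - 1)^+, where E is the
  event in question; its mean is given by Campbell's formula. As (N - 1)^+ = N - 1 + 1{N = 0}, the
  excess has mean x - 1 + exp(-x) \<le> x^2 / 2 with x = b / c.\<close>

lemma exceedance_lower:
  assumes g[measurable]: "g \<in> borel_measurable process_space" and nonneg: "\<And>\<omega>. \<omega> \<in> space Q \<Longrightarrow> 0 \<le> g (V \<omega>)"
    and int: "integrable Q (\<lambda>\<omega>. g (V \<omega>))" and c: "0 < c" and b: "0 < b"
  shows "(\<integral>\<omega>. min (g (V \<omega>)) b \<partial>Q) / c - (b / c)\<^sup>2 / 2 \<le> measure P {\<omega> \<in> space P. \<exists>i. c < U i \<omega> * g (Vs i \<omega>)}"
proof -
  define g' where "g' v = max 0 (min (g v) b)" for v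
  have g'[measurable]: "g' \<in> borel_measurable process_space" unfolding g'_def by measurable
  have g'V: "g' (V \<omega>) = min (g (V \<omega>)) b" if "\<omega> \<in> space Q" for \<omega>
    using nonneg[OF that] b by (simp add: g'_def)
  let ?E = "{\<omega> \<in> space P. \<exists>i. c < U i \<omega> * g (Vs i \<omega>)}"
  let ?N = "exceed_count (c / b)"
  have E: "?E \<in> sets P" by measurable
  have x: "0 < c / b" using b c by simp
  have N1: "ennreal (real (?N \<omega>)) = of_nat (?N \<omega>)" for \<omega> by (simp add: ennreal_of_nat_eq_real_of_nat)
  have intN: "integrable P (\<lambda>\<omega>. real (?N \<omega>))" "(\<integral>\<omega>. real (?N \<omega>) \<partial>P) = b / c"
    using nn_integral_exceed_count[OF x] b c unfolding N1[symmetric]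
    by (auto intro!: integrableI_nonneg simp: integral_eq_nn_integral)
  have "ennreal ((\<integral>\<omega>. min (g (V \<omega>)) b \<partial>Q) / c) = (\<integral>\<^sup>+\<omega>. ennreal (g' (V \<omega>) / c) \<partial>Q)"
  proof -
    have "integrable Q (\<lambda>\<omega>. min (g (V \<omega>)) b)"
      using int Q by (intro integrable_min) (auto intro!: finite_measure.integrable_const simp: prob_space_def)
    then have "ennreal (\<integral>\<omega>. min (g (V \<omega>)) b / c \<partial>Q) = (\<integral>\<^sup>+\<omega>. ennreal (min (g (V \<omega>)) b / c) \<partial>Q)"
      using nonneg b c by (intro nn_integral_eq_integral[symmetric]) auto
    also have "\<dots> = (\<integral>\<^sup>+\<omega>. ennreal (g' (V \<omega>) / c) \<partial>Q)"
      by (intro nn_integral_cong) (simp add: g'V)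
    finally show ?thesis by simp
  qed
  also have "\<dots> = (\<Sum>i. emeasure P {\<omega> \<in> space P. c < U i \<omega> * g' (Vs i \<omega>)})"
    by (intro campbell[symmetric] c g') (simp add: g'_def)
  also have "\<dots> = (\<Sum>i. \<integral>\<^sup>+\<omega>. indicator {\<omega> \<in> space P. c < U i \<omega> * g' (Vs i \<omega>)} \<omega> \<partial>P)"
    by simp
  also have "\<dots> = (\<integral>\<^sup>+\<omega>. (\<Sum>i. indicator {\<omega> \<in> space P. c < U i \<omega> * g' (Vs i \<omega>)} \<omega>) \<partial>P)"
    by (intro nn_integral_suminf[symmetric]) auto
  also have "\<dots> \<le> (\<integral>\<^sup>+\<omega>. ennreal (indicator ?E \<omega> + (real (?N \<omega>) - 1 + indicator {\<omega> \<in> space P. ?N \<omega> = 0} \<omega>)) \<partial>P)"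
  proof (rule nn_integral_mono_AE)
    show "AE \<omega> in P. (\<Sum>i. indicator {\<omega> \<in> space P. c < U i \<omega> * g' (Vs i \<omega>)} \<omega>)
       \<le> ennreal (indicator ?E \<omega> + (real (?N \<omega>) - 1 + indicator {\<omega> \<in> space P. ?N \<omega> = 0} \<omega>))"
      using U_pos exceed_count_finite(1)[OF x] AE_space
    proof eventually_elim
      case (elim \<omega>)
      let ?K = "{i. c < U i \<omega> * g' (Vs i \<omega>)}"
      have sub: "?K \<subseteq> {i. c / b < U i \<omega>}"
      proof safe
        fix i assume "c < U i \<omega> * g' (Vs i \<omega>)"
        also have "\<dots> \<le> U i \<omega> * b" using elim(1) b by (intro mult_left_mono) (auto simp: g'_def less_imp_le)
        finally show "c / b < U i \<omega>" using b by (simp add: divide_less_eq)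
      qed
      then have fin: "finite ?K" using elim(2) finite_subset by blast
      have card: "card ?K \<le> ?N \<omega>" unfolding exceed_count_def using sub elim(2) by (rule card_mono[rotated])
      have "(\<Sum>i. indicator {\<omega> \<in> space P. c < U i \<omega> * g' (Vs i \<omega>)} \<omega>) = (\<Sum>i\<in>?K. 1 :: ennreal)"
        using elim(3) by (subst suminf_finite[OF fin]) auto
      also have "\<dots> = ennreal (real (card ?K))" by (simp add: ennreal_of_nat_eq_real_of_nat)
      also have "real (card ?K) \<le> indicator ?E \<omega> + (real (?N \<omega>) - 1 + indicator {\<omega> \<in> space P. ?N \<omega> = 0} \<omega>)"
      proof (cases "?K = {}")
        case True
        then show ?thesis using elim(3) by (auto split: split_indicator)
      next
        case False
        then obtain i where i: "c < U i \<omega> * g' (Vs i \<omega>)" by auto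
        \<comment> \<open>An exceedance forces \<open>g'\<close> to be positive, so the cut at 0 is
          inactive and \<open>g'\<close> equals \<open>min (g v) b\<close> there.\<close>
        then have "g' (Vs i \<omega>) \<le> g (Vs i \<omega>)" using c by (auto simp: g'_def)
        then have "U i \<omega> * g' (Vs i \<omega>) \<le> U i \<omega> * g (Vs i \<omega>)"
          using elim(1) by (intro mult_left_mono) (auto simp: less_imp_le)
        then have "\<omega> \<in> ?E" using elim(3) i by (auto intro: less_le_trans)
        then show ?thesis using card by (auto split: split_indicator)
      qed
      finally show ?case by (simp add: ennreal_leI)
    qed
  qed
  also have "\<dots> = ennreal (\<integral>\<omega>. indicator ?E \<omega> + (real (?N \<omega>) - 1 + indicator {\<omega> \<in> space P. ?N \<omega> = 0} \<omega>) \<partial>P)"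
    using E intN(1) by (intro nn_integral_eq_integral) (auto intro!: Bochner_Integration.integrable_add
       Bochner_Integration.integrable_diff integrable_real_indicator simp: less_top[symmetric] split: split_indicator)
  also have "(\<integral>\<omega>. indicator ?E \<omega> + (real (?N \<omega>) - 1 + indicator {\<omega> \<in> space P. ?N \<omega> = 0} \<omega>) \<partial>P) =
     measure P ?E + (b / c - 1 + exp (- (b / c)))"
  proof -
    have m0: "{\<omega> \<in> space P. ?N \<omega> = 0} \<in> sets P" by measurable
    have i1: "integrable P (indicator ?E :: _ \<Rightarrow> real)" "integrable P (indicator {\<omega> \<in> space P. ?N \<omega> = 0} :: _ \<Rightarrow> real)"
      using E m0 by (auto simp: less_top[symmetric])
    have "measure P {\<omega> \<in> space P. ?N \<omega> = 0} = exp (- (b / c))"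
      using exceed_count_finite(2)[OF x, of 0] by simp
    then show ?thesis using i1 intN E m0
      by (simp add: prob_space Int_absorb2 sets.sets_into_space)
  qed
  finally have "ennreal ((\<integral>\<omega>. min (g (V \<omega>)) b \<partial>Q) / c) \<le> ennreal (measure P ?E + (b / c - 1 + exp (- (b / c))))" .
  moreover have "0 \<le> measure P ?E + (b / c - 1 + exp (- (b / c)))"
    using exp_ge_add_one_self[of "- (b / c)"] measure_nonneg[of P ?E] by linarith
  ultimately have 1: "(\<integral>\<omega>. min (g (V \<omega>)) b \<partial>Q) / c \<le> measure P ?E + (b / c - 1 + exp (- (b / c)))"
    by (simp add: ennreal_le_iff)
  have "exp (- (b / c)) \<le> 1 - b / c + (b / c)\<^sup>2 / 2"
  proof -
    obtain t where "exp (- (b / c)) = (\<Sum>m<3. (- (b / c)) ^ m / fact m) + exp t / fact 3 * (- (b / c)) ^ 3"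
      using Maclaurin_exp_le[of "- (b / c)" 3] by blast
    moreover have "exp t / fact 3 * (- (b / c)) ^ 3 \<le> 0"
      using b c by (intro mult_nonneg_nonpos) auto
    ultimately show ?thesis by (simp add: eval_nat_numeral)
  qed
  with 1 show ?thesis by linarith
qed

text \<open>For a fixed truncation level b the quadratic correction, multiplied by n, is b^2 / (2 n)
  and vanishes. Dominated convergence allows b to be fixed so large that truncation hardly changes
  the mean. The upper bound holds at every n > 0.\<close>

lemma exceedance_asymptotics:
  assumes g[measurable]: "g \<in> borel_measurable process_space" and nonneg: "\<And>\<omega>. \<omega> \<in> space Q \<Longrightarrow> 0 \<le> g (V \<omega>)"
    and int: "integrable Q (\<lambda>\<omega>. g (V \<omega>))"
  shows "(\<lambda>n. real n * measure P {\<omega> \<in> space P. \<exists>i. real n < U i \<omega> * g (Vs i \<omega>)}) \<longlonglongrightarrow> (\<integral>\<omega>. g (V \<omega>) \<partial>Q)"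
proof (rule order_tendstoI)
  let ?p = "\<lambda>n. measure P {\<omega> \<in> space P. \<exists>i. real n < U i \<omega> * g (Vs i \<omega>)}"
  {
    fix y assume y: "y < (\<integral>\<omega>. g (V \<omega>) \<partial>Q)"
    have "(\<lambda>n. \<integral>\<omega>. min (g (V \<omega>)) (real n) \<partial>Q) \<longlonglongrightarrow> (\<integral>\<omega>. g (V \<omega>) \<partial>Q)"
    proof (rule integral_dominated_convergence[where w="\<lambda>\<omega>. g (V \<omega>)"])
      show "AE \<omega> in Q. (\<lambda>n. min (g (V \<omega>)) (real n)) \<longlonglongrightarrow> g (V \<omega>)"
      proof (rule AE_I2)
        fix \<omega>
        have "\<forall>\<^sub>F n in sequentially. min (g (V \<omega>)) (real n) = g (V \<omega>)"
          using eventually_ge_at_top[of "nat \<lceil>g (V \<omega>)\<rceil>"] by eventually_elim (auto simp: min_def nat_le_iff ceiling_le_iff)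
        then show "(\<lambda>n. min (g (V \<omega>)) (real n)) \<longlonglongrightarrow> g (V \<omega>)" by (simp add: tendsto_eventually)
      qed
    qed (use int nonneg in auto)
    then have "\<forall>\<^sub>F n in sequentially. y < (\<integral>\<omega>. min (g (V \<omega>)) (real n) \<partial>Q)"
      using y by (rule order_tendstoD(1))
    then obtain N where N: "\<And>n. n \<ge> N \<Longrightarrow> y < (\<integral>\<omega>. min (g (V \<omega>)) (real n) \<partial>Q)"
      unfolding eventually_sequentially by blast
    define b where "b = real (max 1 N)"
    have b: "b > 0" "y < (\<integral>\<omega>. min (g (V \<omega>)) b \<partial>Q)" unfolding b_def using N[of "max 1 N"] by auto
    let ?I = "\<integral>\<omega>. min (g (V \<omega>)) b \<partial>Q"
    have "((\<lambda>n. ?I - b\<^sup>2 / 2 / real n) \<longlonglongrightarrow> ?I - 0)"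
      by (intro tendsto_diff tendsto_const tendsto_divide_0[OF tendsto_const]) (auto intro!: filterlim_at_top_imp_at_infinity filterlim_real_sequentially)
    then have "\<forall>\<^sub>F n in sequentially. y < ?I - b\<^sup>2 / 2 / real n"
      using b(2) by (intro order_tendstoD(1)) auto
    then show "\<forall>\<^sub>F n in sequentially. y < real n * ?p n"
      using eventually_gt_at_top[of 0]
    proof eventually_elim
      case (elim n)
      have "real n * (?I / real n - (b / real n)\<^sup>2 / 2) \<le> real n * ?p n"
        using exceedance_lower[OF g nonneg int _ b(1), of "real n"] elim(2) by (intro mult_left_mono) auto
      moreover have "real n * (?I / real n - (b / real n)\<^sup>2 / 2) = ?I - b\<^sup>2 / 2 / real n"
        using elim(2) by (simp add: field_simps power2_eq_square)
      ultimately show ?case using elim(1) by linarith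
    qed
  next
    fix y assume y: "(\<integral>\<omega>. g (V \<omega>) \<partial>Q) < y"
    show "\<forall>\<^sub>F n in sequentially. real n * ?p n < y"
      using eventually_gt_at_top[of 0]
    proof eventually_elim
      case (elim n)
      have "real n * ?p n \<le> real n * ((\<integral>\<omega>. g (V \<omega>) \<partial>Q) / real n)"
        using exceedance_upper[OF g nonneg int, of "real n"] elim by (intro mult_left_mono) auto
      then show ?case using y elim by simp
    qed
  }
qed

end

subsection \<open>The exponent measure and the domain of attraction\<close>

text \<open>Gauge of the box with thresholds \<open>K\<close>: for positive thresholds, dilating the
  box by c \<ge> 0 catches \<open>v\<close> exactly when \<open>tail_max K v \<le> c\<close>. The
  inserted 0 gives the empty \<open>K\<close> a value and makes the gauge non-negative.\<close>

definition tail_max :: "('i \<times> real) set \<Rightarrow> ('i \<Rightarrow> real) \<Rightarrow> real" where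
  "tail_max K v = Max (insert 0 ((\<lambda>(s, r). v s / r) ` K))"

lemma tail_max_empty[simp]: "tail_max {} v = 0"
  by (simp add: tail_max_def)

lemma tail_max_insert: "finite K \<Longrightarrow> tail_max (insert (s, r) K) v = max (v s / r) (tail_max K v)"
  by (simp add: tail_max_def insert_commute[of 0])

lemma tail_max_nonneg: "finite K \<Longrightarrow> 0 \<le> tail_max K v"
  by (simp add: tail_max_def)

lemma less_tail_max:
  assumes "finite K" "\<forall>(s, r)\<in>K. 0 < r" "0 \<le> c"
  shows "c < tail_max K v \<longleftrightarrow> (\<exists>(s, r)\<in>K. c * r < v s)"
proof -
  have "c < tail_max K v \<longleftrightarrow> (\<exists>p\<in>K. c < v (fst p) / snd p)"
    using assms(1,3) unfolding tail_max_def by (subst Max_gr_iff) (auto simp: case_prod_beta')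
  also have "\<dots> \<longleftrightarrow> (\<exists>p\<in>K. c * snd p < v (fst p))"
    using assms(2) by (intro bex_cong) (auto simp: pos_less_divide_eq)
  finally show ?thesis by (simp add: case_prod_beta')
qed

lemma tail_max_le:
  assumes "finite K" "\<forall>(s, r)\<in>K. 0 < r" "0 \<le> c"
  shows "tail_max K v \<le> c \<longleftrightarrow> (\<forall>(s, r)\<in>K. v s \<le> c * r)"
  using less_tail_max[OF assms, of v] by (auto simp: not_less[symmetric])

lemma tail_max_scale:
  assumes "finite K" "0 \<le> c"
  shows "tail_max K (\<lambda>s. c * v s) = c * tail_max K v"
  using assms(1)
proof (induction K rule: finite_induct)
  case (insert p K)
  then show ?case
    using assms(2) by (cases p) (simp add: tail_max_insert max_mult_distrib_left)
qed simp

lemma tail_max_measurable: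
  assumes "finite K" "\<And>s r. (s, r) \<in> K \<Longrightarrow> (\<lambda>\<omega>. X \<omega> s) \<in> borel_measurable M"
  shows "(\<lambda>\<omega>. tail_max K (X \<omega>)) \<in> borel_measurable M"
  using assms
proof (induction K rule: finite_induct)
  case (insert p K)
  obtain s r where p: "p = (s, r)" by fastforce
  show ?case
    unfolding p tail_max_insert[OF insert.hyps(1)]
    by (intro borel_measurable_max borel_measurable_divide borel_measurable_const insert.IH insert.prems) (auto simp: p)
qed simp

lemma tail_max_integrable:
  assumes "finite K" "\<And>s r. (s, r) \<in> K \<Longrightarrow> integrable M (\<lambda>\<omega>. X \<omega> s)"
  shows "integrable M (\<lambda>\<omega>. tail_max K (X \<omega>))"
  using assms
proof (induction K rule: finite_induct)
  case (insert p K)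
  obtain s r where p: "p = (s, r)" by fastforce
  show ?case
    unfolding p tail_max_insert[OF insert.hyps(1)]
    by (intro integrable_max integrable_divide insert.IH insert.prems) (auto simp: p)
qed simp

lemma continuous_tail_max: "finite K \<Longrightarrow> continuous_on UNIV (tail_max K)"
proof (induction K rule: finite_induct)
  case (insert p K)
  have "continuous_on UNIV (\<lambda>v. max (v (fst p) / snd p) (tail_max K v))"
  \<comment> \<open>Division by 0 yields 0, so at a zero threshold the quotient is constant.\<close>
  proof (cases "snd p = 0")
    case False
    then show ?thesis
      by (intro continuous_intros insert.IH continuous_on_product_coordinates) auto
  qed (use insert.IH in \<open>auto intro!: continuous_intros\<close>)
  moreover have "tail_max (insert p K) = (\<lambda>v. max (v (fst p) / snd p) (tail_max K v))"
    using insert.hyps by (cases p) (simp add: tail_max_insert fun_eq_iff)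
  ultimately show ?case by simp
qed (simp add: tail_max_def)

lemma tail_max_cong: "(\<And>s r. (s, r) \<in> K \<Longrightarrow> v s = w s) \<Longrightarrow> tail_max K v = tail_max K w"
  unfolding tail_max_def by (intro arg_cong[where f=Max] arg_cong2[where f=insert] image_cong) auto

section \<open>Limits of powers and of scaled tails\<close>

text \<open>Convergence of n p_n forces p_n to 0; then -p / (1 - p) \<le> ln(1 - p) \<le> -p
  squeezes the logarithm of the power.\<close>

lemma power_one_minus_tendsto_exp:
  fixes p :: "nat \<Rightarrow> real"
  assumes lim: "(\<lambda>n. real n * p n) \<longlonglongrightarrow> l" and p: "\<And>n. 0 \<le> p n"
  shows "(\<lambda>n. (1 - p n) ^ n) \<longlonglongrightarrow> exp (- l)"
proof -
  have "(\<lambda>n. real n * p n * inverse (real n)) \<longlonglongrightarrow> l * 0"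
    by (intro tendsto_mult lim lim_inverse_n)
  moreover have "\<forall>\<^sub>F n in sequentially. real n * p n * inverse (real n) = p n"
    using eventually_gt_at_top[of 0] by eventually_elim simp
  ultimately have p0: "p \<longlonglongrightarrow> 0" by (simp add: tendsto_cong)
  have p1: "\<forall>\<^sub>F n in sequentially. p n < 1" using order_tendstoD(2)[OF p0, of 1] by simp
  have "(\<lambda>n. real n * ln (1 - p n)) \<longlonglongrightarrow> - l"
  proof (rule tendsto_sandwich)
    show "\<forall>\<^sub>F n in sequentially. - (real n * p n / (1 - p n)) \<le> real n * ln (1 - p n)"
      using p1
    proof eventually_elim
      case (elim n)
      have "ln (1 / (1 - p n)) \<le> 1 / (1 - p n) - 1" using elim by (intro ln_le_minus_one) auto
      then have "- (p n / (1 - p n)) \<le> ln (1 - p n)" using elim by (simp add: ln_div field_simps)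
      then have "real n * - (p n / (1 - p n)) \<le> real n * ln (1 - p n)" by (intro mult_left_mono) auto
      then show ?case by simp
    qed
    show "\<forall>\<^sub>F n in sequentially. real n * ln (1 - p n) \<le> - (real n * p n)"
      using p1
    proof eventually_elim
      case (elim n)
      have "ln (1 - p n) \<le> - p n" using ln_le_minus_one[of "1 - p n"] elim by simp
      then have "real n * ln (1 - p n) \<le> real n * - p n" by (intro mult_left_mono) auto
      then show ?case by simp
    qed
    have "(\<lambda>n. - (real n * p n / (1 - p n))) \<longlonglongrightarrow> - (l / (1 - 0))"
      by (intro tendsto_intros lim p0) auto
    then show "(\<lambda>n. - (real n * p n / (1 - p n))) \<longlonglongrightarrow> - l" by simp
    show "(\<lambda>n. - (real n * p n)) \<longlonglongrightarrow> - l" by (intro tendsto_intros lim)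
  qed
  then have "(\<lambda>n. exp (real n * ln (1 - p n))) \<longlonglongrightarrow> exp (- l)" by (intro tendsto_intros)
  moreover have "\<forall>\<^sub>F n in sequentially. exp (real n * ln (1 - p n)) = (1 - p n) ^ n"
    using p1 by eventually_elim (simp add: exp_of_nat_mult)
  ultimately show ?thesis by (simp add: tendsto_cong)
qed

text \<open>Taking logarithms, n ln(h_n) tends to -l, which forces h_n to 1; then -h ln h \<le> 1 -
  h \<le> -ln h gives the rate.\<close>

lemma one_minus_root_asymptotics:
  fixes h :: "nat \<Rightarrow> real"
  assumes lim: "(\<lambda>n. h n ^ n) \<longlonglongrightarrow> exp (- l)" and h: "\<And>n. 0 \<le> h n" "\<And>n. h n \<le> 1"
  shows "(\<lambda>n. real n * (1 - h n)) \<longlonglongrightarrow> l"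
proof -
  have "\<forall>\<^sub>F n in sequentially. 0 < h n ^ n" using order_tendstoD(1)[OF lim, of 0] by simp
  then have pos: "\<forall>\<^sub>F n in sequentially. 0 < h n"
    using eventually_gt_at_top[of 0]
  proof eventually_elim
    case (elim n)
    then show ?case using h(1)[of n] by (cases "h n = 0") (auto simp: power_0_left)
  qed
  have "(\<lambda>n. ln (h n ^ n)) \<longlonglongrightarrow> ln (exp (- l))" by (intro tendsto_ln lim) simp
  moreover have "\<forall>\<^sub>F n in sequentially. ln (h n ^ n) = real n * ln (h n)"
    using pos by eventually_elim (simp add: ln_realpow)
  ultimately have ln: "(\<lambda>n. real n * ln (h n)) \<longlonglongrightarrow> - l" by (simp add: tendsto_cong)
  have "(\<lambda>n. exp (real n * ln (h n) * inverse (real n))) \<longlonglongrightarrow> exp (- l * 0)"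
    by (intro tendsto_intros ln lim_inverse_n)
  moreover have "\<forall>\<^sub>F n in sequentially. exp (real n * ln (h n) * inverse (real n)) = h n"
    using pos eventually_gt_at_top[of 0]
  proof eventually_elim
    case (elim n)
    then have "real n * ln (h n) * inverse (real n) = ln (h n)" by simp
    then show ?case using elim by (simp only: exp_ln)
  qed
  ultimately have h1: "h \<longlonglongrightarrow> 1" by (simp add: tendsto_cong)
  show ?thesis
  proof (rule tendsto_sandwich)
    show "\<forall>\<^sub>F n in sequentially. h n * - (real n * ln (h n)) \<le> real n * (1 - h n)"
      using pos
    proof eventually_elim
      case (elim n)
      have "ln (1 / h n) \<le> 1 / h n - 1" using elim by (intro ln_le_minus_one) auto
      then have "h n * - ln (h n) \<le> h n * (1 / h n - 1)"
        using elim by (intro mult_left_mono) (auto simp: ln_div)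
      also have "\<dots> = 1 - h n" using elim by (simp add: field_simps)
      finally have "real n * (h n * - ln (h n)) \<le> real n * (1 - h n)" by (intro mult_left_mono) auto
      then show ?case by (simp add: mult_ac)
    qed
    show "\<forall>\<^sub>F n in sequentially. real n * (1 - h n) \<le> - (real n * ln (h n))"
      using pos
    proof eventually_elim
      case (elim n)
      have "1 - h n \<le> - ln (h n)" using ln_le_minus_one[OF elim] by simp
      then have "real n * (1 - h n) \<le> real n * - ln (h n)" by (intro mult_left_mono) auto
      then show ?case by simp
    qed
    have "(\<lambda>n. h n * - (real n * ln (h n))) \<longlonglongrightarrow> 1 * - (- l)" by (intro tendsto_intros h1 ln)
    then show "(\<lambda>n. h n * - (real n * ln (h n))) \<longlonglongrightarrow> l" by simp
    have "(\<lambda>n. - (real n * ln (h n))) \<longlonglongrightarrow> - (- l)" by (intro tendsto_intros ln)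
    then show "(\<lambda>n. - (real n * ln (h n))) \<longlonglongrightarrow> l" by simp
  qed
qed

text \<open>Monotonicity bridges the gaps between integers: with n = floor y, n p(n + 1) \<le> y
  p(y) \<le> (n + 1) p(n). The mismatched factors n / (n + 1) and (n + 1) / n tend to 1.\<close>

lemma antimono_scaled_at_top:
  fixes p :: "real \<Rightarrow> real"
  assumes lim: "(\<lambda>n. real n * p (real n)) \<longlonglongrightarrow> l"
    and p: "\<And>x y. 0 \<le> x \<Longrightarrow> x \<le> y \<Longrightarrow> p y \<le> p x" "\<And>x. 0 \<le> p x"
  shows "((\<lambda>y. y * p y) \<longlongrightarrow> l) at_top"
proof -
  let ?n = "\<lambda>y::real. nat \<lfloor>y\<rfloor>"
  have n: "filterlim ?n sequentially at_top"
    by (intro filterlim_compose[OF filterlim_nat_sequentially] filterlim_floor_sequentially)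
  have inv: "(\<lambda>n. inverse (real n)) \<longlonglongrightarrow> 0" by (rule lim_inverse_n)
  have up: "(\<lambda>n. real n * p (real n) * (1 + inverse (real n))) \<longlonglongrightarrow> l * (1 + 0)"
    by (intro tendsto_intros lim inv)
  have lo: "(\<lambda>n. real (Suc n) * p (real (Suc n)) * (1 - inverse (real (Suc n)))) \<longlonglongrightarrow> l * (1 - 0)"
    by (intro tendsto_intros LIMSEQ_Suc[OF lim] LIMSEQ_Suc[OF inv])
  show ?thesis
  proof (rule tendsto_sandwich)
    show "\<forall>\<^sub>F y in at_top. real (Suc (?n y)) * p (real (Suc (?n y))) * (1 - inverse (real (Suc (?n y)))) \<le> y * p y"
      using eventually_ge_at_top[of 1]
    proof eventually_elim
      case (elim y)
      have "real (?n y) \<le> y" "y \<le> real (Suc (?n y))" using elim by linarith+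
      then have "real (?n y) * p (real (Suc (?n y))) \<le> y * p y"
        using elim p(1)[of y "real (Suc (?n y))"] p(2) by (intro mult_mono) auto
      moreover have "real (Suc k) * q * (1 - inverse (real (Suc k))) = real k * q" for k q
      proof -
        have "real (Suc k) * (1 - inverse (real (Suc k))) = real (Suc k) - 1"
          by (simp add: right_diff_distrib del: of_nat_Suc)
        then show ?thesis by (simp add: mult_ac)
      qed
      ultimately show ?case by (simp only:)
    qed
    show "\<forall>\<^sub>F y in at_top. y * p y \<le> real (?n y) * p (real (?n y)) * (1 + inverse (real (?n y)))"
      using eventually_ge_at_top[of 1]
    proof eventually_elim
      case (elim y)
      have n: "real (?n y) \<le> y" "y \<le> real (?n y) + 1" using elim by linarith+
      have n1: "1 \<le> real (?n y)" using elim le_nat_floor[of 1 y] by simp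
      have "y * p y \<le> (real (?n y) + 1) * p (real (?n y))"
        using n elim p(1)[of "real (?n y)" y] p(2) by (intro mult_mono) auto
      also have "\<dots> = real (?n y) * p (real (?n y)) * (1 + inverse (real (?n y)))"
      proof -
        have "(x + 1) * q = x * q * (1 + inverse x)" if "x \<noteq> 0" for x q :: real
          using that by (simp add: field_simps)
        moreover have "real (?n y) \<noteq> 0" using n1 by linarith
        ultimately show ?thesis by blast
      qed
      finally show ?case .
    qed
    show "((\<lambda>y. real (?n y) * p (real (?n y)) * (1 + inverse (real (?n y)))) \<longlongrightarrow> l) at_top"
      using filterlim_compose[OF up n] by simp
    show "((\<lambda>y. real (Suc (?n y)) * p (real (Suc (?n y))) * (1 - inverse (real (Suc (?n y))))) \<longlongrightarrow> l) at_top"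
      using filterlim_compose[OF lo n] by simp
  qed
qed

lemma process_coord_measurable[measurable (raw)]:
  "X \<in> measurable M process_space \<Longrightarrow> (\<lambda>\<omega>. X \<omega> s) \<in> borel_measurable M"
  by (rule measurable_compose[where N=process_space])
    (auto simp: process_space_def intro: measurable_component_singleton)

lemma space_process_space[simp]: "space process_space = UNIV"
  by (simp add: process_space_def space_PiM)

section \<open>Max-stability of \<xi> and tails of \<eta>\<close>

locale max_domain = spectral_points P U Vs Q V
  for P :: "'c measure" and U :: "nat \<Rightarrow> 'c \<Rightarrow> real" and Vs :: "nat \<Rightarrow> 'c \<Rightarrow> 't \<Rightarrow> real"
    and Q :: "'d measure" and V :: "'d \<Rightarrow> 't \<Rightarrow> real" +
  fixes M :: "'a measure" and \<eta> :: "'a \<Rightarrow> 't \<Rightarrow> real"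
    and N :: "'b measure" and \<eta>c :: "nat \<Rightarrow> 'b \<Rightarrow> 't \<Rightarrow> real"
    and \<xi> :: "'c \<Rightarrow> 't \<Rightarrow> real"
  assumes M: "prob_space M" and N: "prob_space N"
    and V_nonneg: "\<And>\<omega> s. \<omega> \<in> space Q \<Longrightarrow> 0 \<le> V \<omega> s"
    and V_int: "\<And>s. integrable Q (\<lambda>\<omega>. V \<omega> s)"
    and V_mean: "\<And>s. (\<integral>\<omega>. V \<omega> s \<partial>Q) = 1"
    and xi_meas[measurable]: "\<xi> \<in> measurable P process_space"
    and xi_frechet: "\<And>s x. 0 < x \<Longrightarrow> measure P {\<omega> \<in> space P. \<xi> \<omega> s \<le> x} = exp (- 1 / x)"
    and xi_repr: "\<And>s. AE \<omega> in P. (\<exists>i. \<xi> \<omega> s = U i \<omega> * Vs i \<omega> s) \<and>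
                                  (\<forall>i. U i \<omega> * Vs i \<omega> s \<le> \<xi> \<omega> s)"
    and eta_meas[measurable]: "\<eta> \<in> measurable M process_space"
    and eta_nonneg: "\<And>\<omega> s. \<omega> \<in> space M \<Longrightarrow> 0 \<le> \<eta> \<omega> s"
    and etac_meas[measurable]: "\<And>i. \<eta>c i \<in> measurable N process_space"
    and etac_indep: "prob_space.indep_vars N (\<lambda>_. process_space) \<eta>c UNIV"
    and etac_law: "\<And>i. distr N process_space (\<eta>c i) = distr M process_space \<eta>"
    and mda: "\<And>(m::nat) (s :: nat \<Rightarrow> 't).
       weak_conv_on (PiE {..<m} (\<lambda>_. UNIV))
         (\<lambda>n. distr N (PiM {..<m} (\<lambda>_. borel))
                (\<lambda>\<omega>. \<lambda>j\<in>{..<m}. (MAX i\<in>{..<n}. \<eta>c i \<omega> (s j)) / real n))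
         (distr P (PiM {..<m} (\<lambda>_. borel)) (\<lambda>\<omega>. \<lambda>j\<in>{..<m}. \<xi> \<omega> (s j)))"
begin

text \<open>The exponent function of \<xi>: for positive thresholds it is minus the logarithm of the
  joint distribution function, by \<open>xi_cdf\<close>.\<close>

definition exponent :: "('t \<times> real) set \<Rightarrow> real" where
  "exponent K = (\<integral>\<omega>. tail_max K (V \<omega>) \<partial>Q)"

text \<open>The representation holds almost surely at each site, and \<open>K\<close> involves
  finitely many sites, so one null set serves all. Domination of \<open>U i * Vs i\<close> by \<xi>
  gives one inclusion of events and attainment of the maximum the other; \<open>tail_max\<close>
  merges the thresholds into a single function.\<close>

lemma xi_exceedance:
  assumes K: "finite K" "\<forall>(s, r)\<in>K. 0 < r"
  shows "(\<lambda>n. real n * measure P {\<omega> \<in> space P. \<exists>(s, r)\<in>K. real n * r < \<xi> \<omega> s}) \<longlonglongrightarrow> exponent K"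
proof -
  have tm: "tail_max K \<in> borel_measurable process_space"
    using K(1) by (intro tail_max_measurable[where X="\<lambda>v. v"]) auto
  have "measure P {\<omega> \<in> space P. \<exists>i. real n < U i \<omega> * tail_max K (Vs i \<omega>)} =
      measure P {\<omega> \<in> space P. \<exists>(s, r)\<in>K. real n * r < \<xi> \<omega> s}" for n
  proof (rule finite_measure_eq_AE)
    have "AE \<omega> in P. \<forall>p\<in>K. (\<exists>i. \<xi> \<omega> (fst p) = U i \<omega> * Vs i \<omega> (fst p)) \<and>
        (\<forall>i. U i \<omega> * Vs i \<omega> (fst p) \<le> \<xi> \<omega> (fst p))"
      using K(1) xi_repr by (intro AE_finite_allI) auto
    then show "AE \<omega> in P. \<omega> \<in> {\<omega> \<in> space P. \<exists>i. real n < U i \<omega> * tail_max K (Vs i \<omega>)} \<longleftrightarrow>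
       \<omega> \<in> {\<omega> \<in> space P. \<exists>(s, r)\<in>K. real n * r < \<xi> \<omega> s}"
      using U_pos
    proof eventually_elim
      case (elim \<omega>)
      have "real n < U i \<omega> * tail_max K (Vs i \<omega>) \<longleftrightarrow> (\<exists>(s, r)\<in>K. real n * r < U i \<omega> * Vs i \<omega> s)" for i
      proof -
        have u: "0 < U i \<omega>" using elim by auto
        have "real n < U i \<omega> * tail_max K (Vs i \<omega>) \<longleftrightarrow> real n / U i \<omega> < tail_max K (Vs i \<omega>)"
          using u by (simp add: divide_less_eq mult.commute)
        also have "\<dots> \<longleftrightarrow> (\<exists>(s, r)\<in>K. real n / U i \<omega> * r < Vs i \<omega> s)"
          using u by (intro less_tail_max K) auto
        also have "\<dots> \<longleftrightarrow> (\<exists>(s, r)\<in>K. real n * r < U i \<omega> * Vs i \<omega> s)"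
          using u by (intro bex_cong) (auto simp: field_simps)
        finally show ?thesis .
      qed
      moreover have "(\<exists>i. \<exists>(s, r)\<in>K. real n * r < U i \<omega> * Vs i \<omega> s) \<longleftrightarrow> (\<exists>(s, r)\<in>K. real n * r < \<xi> \<omega> s)"
      proof
        assume "\<exists>i. \<exists>(s, r)\<in>K. real n * r < U i \<omega> * Vs i \<omega> s"
        then obtain i p where p: "p \<in> K" "real n * snd p < U i \<omega> * Vs i \<omega> (fst p)" by auto
        then have "real n * snd p < \<xi> \<omega> (fst p)" using elim(1) by (meson less_le_trans)
        then show "\<exists>(s, r)\<in>K. real n * r < \<xi> \<omega> s" using p by (intro bexI[of _ p]) auto
      next
        assume "\<exists>(s, r)\<in>K. real n * r < \<xi> \<omega> s"
        then obtain p where p: "p \<in> K" "real n * snd p < \<xi> \<omega> (fst p)" by auto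
        then obtain i where "\<xi> \<omega> (fst p) = U i \<omega> * Vs i \<omega> (fst p)" using elim(1) by blast
        then show "\<exists>i. \<exists>(s, r)\<in>K. real n * r < U i \<omega> * Vs i \<omega> s"
          using p by (intro exI[of _ i] bexI[of _ p]) auto
      qed
      ultimately show ?case by auto
    qed
    show "{\<omega> \<in> space P. \<exists>i. real n < U i \<omega> * tail_max K (Vs i \<omega>)} \<in> events"
      using tm by measurable
    have "{\<omega> \<in> space P. \<exists>(s, r)\<in>K. real n * r < \<xi> \<omega> s} = {\<omega> \<in> space P. real n < tail_max K (\<xi> \<omega>)}"
      using less_tail_max[OF K] by auto
    also have "\<dots> \<in> events" using tm by measurable
    finally show "{\<omega> \<in> space P. \<exists>(s, r)\<in>K. real n * r < \<xi> \<omega> s} \<in> events" .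
  qed
  then show ?thesis
    using exceedance_asymptotics[OF tm] K(1) V_int unfolding exponent_def
    by (simp add: tail_max_nonneg tail_max_integrable)
qed

lemma xi_no_atom:
  assumes "0 < r"
  shows "measure P {\<omega> \<in> space P. \<xi> \<omega> s = r} = 0"
proof -
  let ?D = "distr P borel (\<lambda>\<omega>. \<xi> \<omega> s)"
  interpret D: real_distribution ?D by (intro real_distribution_distr) measurable
  have c: "cdf ?D x = exp (- 1 / x)" if "0 < x" for x
    using xi_frechet[OF that, of s] unfolding cdf_def
    by (subst measure_distr) (auto intro!: arg_cong[where f="measure P"] simp: vimage_def Int_def conj_commute)
  have "\<forall>\<^sub>F x in nhds r. cdf ?D x = exp (- 1 / x)"
    using eventually_nhds_in_open[of "{0<..}" r] assms by (auto elim!: eventually_mono simp: c)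
  moreover have "isCont (\<lambda>x::real. exp (- 1 / x)) r" using assms by (intro continuous_intros) auto
  ultimately have "isCont (cdf ?D) r" by (simp add: isCont_cong)
  then have "measure ?D {r} = 0" by (simp add: D.isCont_cdf)
  then show ?thesis
    by (subst (asm) measure_distr) (auto simp: vimage_def Int_def conj_commute)
qed

text \<open>The box is the set where the continuous function \<open>tail_max\<close> is at most 1,
  so the finite-dimensional limit reduces to convergence of a real distribution function at 1. The
  Frechet margins make 1 a continuity point, and independence of the copies produces the n-th
  power.\<close>

lemma maxima_cdf:
  assumes K: "finite K" "\<forall>(s, r)\<in>K. 0 < r"
  shows "(\<lambda>n. measure M {\<omega> \<in> space M. \<forall>(s, r)\<in>K. \<eta> \<omega> s \<le> real n * r} ^ n)
    \<longlonglongrightarrow> measure P {\<omega> \<in> space P. \<forall>(s, r)\<in>K. \<xi> \<omega> s \<le> r}"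
proof -
  interpret N: prob_space N by (rule N)
  \<comment> \<open>The pairs are enumerated rather than the sites: a site with several thresholds
    occupies several coordinates.\<close>
  obtain h where "bij_betw h {..<card K} K"
    using ex_bij_betw_nat_finite[OF K(1)] by (auto simp: atLeast0LessThan)
  then have h: "h ` {..<card K} = K" by (simp add: bij_betw_def)
  define m where "m = card K"
  define s where "s j = fst (h j)" for j
  define r where "r j = snd (h j)" for j
  define L where "L = (\<lambda>j. (j, r j)) ` {..<m}"
  have hK: "K = h ` {..<m}" using h by (simp add: m_def)
  have KL: "(\<forall>(s', r')\<in>K. P s' r') \<longleftrightarrow> (\<forall>j<m. P (s j) (r j))" for P
    unfolding hK by (auto simp: s_def r_def case_prod_beta')
  have r: "0 < r j" if "j < m" for j using K(2) that unfolding KL by auto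
  have L: "finite L" "\<forall>(j, x)\<in>L. 0 < x" using r by (auto simp: L_def)
  define X where "X n \<omega> j = (MAX i\<in>{..<n}. \<eta>c i \<omega> (s j)) / real n" for n \<omega> j
  have X[measurable]: "(\<lambda>\<omega>. X n \<omega> j) \<in> borel_measurable N" for n j unfolding X_def by measurable
  have mX: "(\<lambda>\<omega>. tail_max L (X n \<omega>)) \<in> borel_measurable N" for n
    by (intro tail_max_measurable L) measurable
  have mY: "(\<lambda>\<omega>. tail_max L (\<lambda>j. \<xi> \<omega> (s j))) \<in> borel_measurable P"
    by (intro tail_max_measurable L) measurable
  have mR: "tail_max L \<in> borel_measurable (PiM {..<m} (\<lambda>_. borel))"
    by (intro tail_max_measurable[where X="\<lambda>v. v"] L) (auto simp: L_def)
  let ?\<mu> = "\<lambda>n. distr N borel (\<lambda>\<omega>. tail_max L (X n \<omega>))"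
  let ?\<nu> = "distr P borel (\<lambda>\<omega>. tail_max L (\<lambda>j. \<xi> \<omega> (s j)))"
  \<comment> \<open>Outside \<open>{..<m}\<close> the restricted vector is \<open>undefined\<close>,
    but \<open>L\<close> never reads those coordinates.\<close>
  have res: "tail_max L (\<lambda>j\<in>{..<m}. v j) = tail_max L v" for v
    by (intro tail_max_cong) (auto simp: L_def)
  have "weak_conv_m ?\<mu> ?\<nu>"
  proof (rule integral_bdd_continuous_conv_imp_weak_conv)
    fix f :: "real \<Rightarrow> real" assume f: "\<And>x. isCont f x" "\<And>x. \<bar>f x\<bar> \<le> 1"
    have fm[measurable]: "f \<in> borel_measurable borel"
      using f(1) by (intro borel_measurable_continuous_onI) (simp add: continuous_at_imp_continuous_on)
    have "continuous_on UNIV (\<lambda>v. f (tail_max L v))"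
      using f(1) by (intro continuous_on_compose2[OF _ continuous_tail_max[OF L(1)], of UNIV])
        (auto simp: continuous_at_imp_continuous_on)
    then have "continuous_on (PiE {..<m} (\<lambda>_. UNIV)) (\<lambda>v. f (tail_max L v))"
      by (rule continuous_on_subset) auto
    moreover have "bounded ((\<lambda>v. f (tail_max L v)) ` PiE {..<m} (\<lambda>_. UNIV))"
      using f(2) by (auto simp: bounded_iff)
    ultimately have "(\<lambda>n. \<integral>v. f (tail_max L v) \<partial>distr N (PiM {..<m} (\<lambda>_. borel)) (\<lambda>\<omega>. \<lambda>j\<in>{..<m}. X n \<omega> j))
      \<longlonglongrightarrow> (\<integral>v. f (tail_max L v) \<partial>distr P (PiM {..<m} (\<lambda>_. borel)) (\<lambda>\<omega>. \<lambda>j\<in>{..<m}. \<xi> \<omega> (s j)))"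
      using mda[of m s] unfolding weak_conv_on_def X_def by blast
    moreover have "(\<integral>v. f (tail_max L v) \<partial>distr N (PiM {..<m} (\<lambda>_. borel)) (\<lambda>\<omega>. \<lambda>j\<in>{..<m}. X n \<omega> j)) = (\<integral>x. f x \<partial>?\<mu> n)" for n
      using mR mX by (subst integral_distr) (auto simp: integral_distr res intro!: measurable_compose[OF _ fm])
    moreover have "(\<integral>v. f (tail_max L v) \<partial>distr P (PiM {..<m} (\<lambda>_. borel)) (\<lambda>\<omega>. \<lambda>j\<in>{..<m}. \<xi> \<omega> (s j))) = (\<integral>x. f x \<partial>?\<nu>)"
      using mR mY by (subst integral_distr) (auto simp: integral_distr res intro!: measurable_compose[OF _ fm])
    ultimately show "(\<lambda>n. \<integral>x. f x \<partial>?\<mu> n) \<longlonglongrightarrow> (\<integral>x. f x \<partial>?\<nu>)" by simp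
  qed (use mX mY in auto)
  moreover have "isCont (cdf ?\<nu>) 1"
  proof -
    interpret D: real_distribution ?\<nu> using mY by auto
    have "measure ?\<nu> {1} = measure P {\<omega> \<in> space P. tail_max L (\<lambda>j. \<xi> \<omega> (s j)) = 1}"
      using mY by (subst measure_distr) (auto intro!: arg_cong[where f="measure P"])
    also have "\<dots> \<le> measure P (\<Union>j\<in>{..<m}. {\<omega> \<in> space P. \<xi> \<omega> (s j) = r j})"
    proof (rule finite_measure_mono)
      show "{\<omega> \<in> space P. tail_max L (\<lambda>j. \<xi> \<omega> (s j)) = 1} \<subseteq> (\<Union>j\<in>{..<m}. {\<omega> \<in> space P. \<xi> \<omega> (s j) = r j})"
      proof safe
        fix \<omega> assume w: "tail_max L (\<lambda>j. \<xi> \<omega> (s j)) = 1" "\<omega> \<in> space P"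
        \<comment> \<open>The value 1 is not the inserted 0, so some coordinate lies exactly on its
          threshold.\<close>
        then have "1 \<in> insert 0 ((\<lambda>(j, x). \<xi> \<omega> (s j) / x) ` L)"
          using Max_in[of "insert 0 ((\<lambda>(j, x). \<xi> \<omega> (s j) / x) ` L)"] L(1) unfolding tail_max_def by auto
        then obtain j where "j < m" "\<xi> \<omega> (s j) / r j = 1" by (auto simp: L_def)
        then show "\<omega> \<in> (\<Union>j\<in>{..<m}. {\<omega> \<in> space P. \<xi> \<omega> (s j) = r j})"
          using w(2) by (intro UN_I[of j]) (auto simp: divide_eq_1_iff)
      qed
    qed auto
    also have "\<dots> \<le> (\<Sum>j\<in>{..<m}. measure P {\<omega> \<in> space P. \<xi> \<omega> (s j) = r j})"
      by (intro measure_UNION_le) auto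
    also have "\<dots> = 0" using xi_no_atom r by simp
    finally show ?thesis by (simp add: D.isCont_cdf measure_le_0_iff)
  qed
  ultimately have "(\<lambda>n. cdf (?\<mu> n) 1) \<longlonglongrightarrow> cdf ?\<nu> 1"
    unfolding weak_conv_m_def weak_conv_def by blast
  moreover have "cdf ?\<nu> 1 = measure P {\<omega> \<in> space P. \<forall>(s, r)\<in>K. \<xi> \<omega> s \<le> r}"
  proof -
    have "tail_max L v \<le> 1 \<longleftrightarrow> (\<forall>j<m. v j \<le> r j)" for v
      using tail_max_le[OF L, of 1 v] by (auto simp: L_def)
    then show ?thesis
      unfolding cdf_def KL using mY by (subst measure_distr) (auto intro!: arg_cong[where f="measure P"])
  qed
  moreover have "\<forall>\<^sub>F n in sequentially. cdf (?\<mu> n) 1 = measure M {\<omega> \<in> space M. \<forall>(s, r)\<in>K. \<eta> \<omega> s \<le> real n * r} ^ n"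
    \<comment> \<open>\<open>n > 0\<close> excludes a maximum over the empty set and a division by
      0.\<close>
    using eventually_gt_at_top[of 0]
  proof eventually_elim
    case (elim n)
    define A where "A = {v \<in> space process_space. \<forall>j\<in>{..<m}. v (s j) \<le> real n * r j}"
    have A: "A \<in> sets process_space" unfolding A_def by measurable
    have eq: "X n \<omega> j \<le> r j \<longleftrightarrow> (\<forall>i<n. \<eta>c i \<omega> (s j) \<le> real n * r j)" for \<omega> j
    proof -
      have "X n \<omega> j \<le> r j \<longleftrightarrow> (MAX i\<in>{..<n}. \<eta>c i \<omega> (s j)) \<le> real n * r j"
        using elim by (simp add: X_def divide_le_eq mult.commute)
      also have "\<dots> \<longleftrightarrow> (\<forall>i<n. \<eta>c i \<omega> (s j) \<le> real n * r j)" using elim by (subst Max_le_iff) auto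
      finally show ?thesis .
    qed
    have "tail_max L v \<le> 1 \<longleftrightarrow> (\<forall>j<m. v j \<le> r j)" for v
      using tail_max_le[OF L, of 1 v] by (auto simp: L_def)
    then have "cdf (?\<mu> n) 1 = measure N {\<omega> \<in> space N. \<forall>j<m. X n \<omega> j \<le> r j}"
      unfolding cdf_def using mX by (subst measure_distr) (auto intro!: arg_cong[where f="measure N"])
    also have "{\<omega> \<in> space N. \<forall>j<m. X n \<omega> j \<le> r j} = (\<Inter>i\<in>{..<n}. \<eta>c i -` A \<inter> space N)"
      using elim by (auto simp: A_def eq)
    also have "measure N \<dots> = (\<Prod>i\<in>{..<n}. measure N (\<eta>c i -` A \<inter> space N))"
      using elim A by (intro N.indep_varsD[OF etac_indep]) auto
    also have "\<dots> = (\<Prod>i\<in>{..<n}. measure M (\<eta> -` A \<inter> space M))"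
    proof (rule prod.cong)
      fix i
      show "measure N (\<eta>c i -` A \<inter> space N) = measure M (\<eta> -` A \<inter> space M)"
        using measure_distr[OF etac_meas A, of i] measure_distr[OF eta_meas A] etac_law[of i] by simp
    qed simp
    also have "\<eta> -` A \<inter> space M = {\<omega> \<in> space M. \<forall>(s, r)\<in>K. \<eta> \<omega> s \<le> real n * r}"
      unfolding KL by (auto simp: A_def)
    finally show ?case by simp
  qed
  ultimately show ?thesis by (simp add: tendsto_cong)
qed

text \<open>Let H(n) be the probability that \<eta> stays below n times the thresholds. Then H(c
  n)^n tends to the distribution function of \<xi> at thresholds scaled by \<open>c\<close>, while
  its c-th power H(c n)^(c n) is a subsequence of the sequence for the original thresholds.\<close>

lemma xi_max_stable:
  assumes K: "finite K" "\<forall>(s, r)\<in>K. 0 < r" and c: "0 < c"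
  shows "measure P {\<omega> \<in> space P. \<forall>(s, r)\<in>K. \<xi> \<omega> s \<le> r} =
     measure P {\<omega> \<in> space P. \<forall>(s, r)\<in>K. \<xi> \<omega> s \<le> real c * r} ^ c"
proof -
  let ?H = "\<lambda>n. measure M {\<omega> \<in> space M. \<forall>(s, r)\<in>K. \<eta> \<omega> s \<le> real n * r}"
  let ?K = "(\<lambda>(s, r). (s, real c * r)) ` K"
  have "(\<lambda>n. measure M {\<omega> \<in> space M. \<forall>(s, r)\<in>?K. \<eta> \<omega> s \<le> real n * r} ^ n)
    \<longlonglongrightarrow> measure P {\<omega> \<in> space P. \<forall>(s, r)\<in>?K. \<xi> \<omega> s \<le> r}"
    using K c by (intro maxima_cdf) auto
  moreover have "(\<forall>(s, r)\<in>?K. f s \<le> y * r) \<longleftrightarrow> (\<forall>(s, r)\<in>K. f s \<le> real c * y * r)" for f :: "'t \<Rightarrow> real" and y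
    by (simp add: case_prod_beta' mult_ac)
  moreover have "(\<forall>(s, r)\<in>?K. f s \<le> r) \<longleftrightarrow> (\<forall>(s, r)\<in>K. f s \<le> real c * r)" for f :: "'t \<Rightarrow> real"
    by (simp add: case_prod_beta')
  ultimately have "(\<lambda>n. ?H (c * n) ^ n) \<longlonglongrightarrow> measure P {\<omega> \<in> space P. \<forall>(s, r)\<in>K. \<xi> \<omega> s \<le> real c * r}"
    by simp
  then have "(\<lambda>n. (?H (c * n) ^ n) ^ c) \<longlonglongrightarrow> measure P {\<omega> \<in> space P. \<forall>(s, r)\<in>K. \<xi> \<omega> s \<le> real c * r} ^ c"
    by (rule tendsto_power)
  moreover have "(\<lambda>n. ?H (c * n) ^ (c * n)) \<longlonglongrightarrow> measure P {\<omega> \<in> space P. \<forall>(s, r)\<in>K. \<xi> \<omega> s \<le> r}"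
    using filterlim_compose[OF maxima_cdf[OF K], of "\<lambda>n. c * n" sequentially] c
    by (simp add: mult_nat_left_at_top)
  ultimately show ?thesis
    by (intro LIMSEQ_unique) (simp_all add: power_mult[symmetric] mult.commute)
qed

text \<open>By max-stability the powers (1 - p_n)^n are all equal for n > 0, and
  \<open>xi_exceedance\<close> supplies their limit.\<close>

lemma xi_cdf:
  assumes K: "finite K" "\<forall>(s, r)\<in>K. 0 < r"
  shows "measure P {\<omega> \<in> space P. \<forall>(s, r)\<in>K. \<xi> \<omega> s \<le> r} = exp (- exponent K)"
proof -
  let ?p = "\<lambda>n. measure P {\<omega> \<in> space P. \<exists>(s, r)\<in>K. real n * r < \<xi> \<omega> s}"
  let ?F = "measure P {\<omega> \<in> space P. \<forall>(s, r)\<in>K. \<xi> \<omega> s \<le> r}"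
  have "1 - ?p n = measure P {\<omega> \<in> space P. \<forall>(s, r)\<in>K. \<xi> \<omega> s \<le> real n * r}" for n
  proof -
    have "{\<omega> \<in> space P. \<exists>(s, r)\<in>K. real n * r < \<xi> \<omega> s} = {\<omega> \<in> space P. real n < tail_max K (\<xi> \<omega>)}"
      using less_tail_max[OF K] by auto
    also have "\<dots> \<in> events"
      using tail_max_measurable[OF K(1), of \<xi> P] by measurable
    finally have "1 - ?p n = prob (space P - {\<omega> \<in> space P. \<exists>(s, r)\<in>K. real n * r < \<xi> \<omega> s})"
      by (simp add: prob_compl)
    also have "space P - {\<omega> \<in> space P. \<exists>(s, r)\<in>K. real n * r < \<xi> \<omega> s} = {\<omega> \<in> space P. \<forall>(s, r)\<in>K. \<xi> \<omega> s \<le> real n * r}"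
      by (fastforce simp: not_less case_prod_beta')
    finally show ?thesis .
  qed
  note compl = this
  have "\<forall>\<^sub>F n in sequentially. (1 - ?p n) ^ n = ?F"
    using eventually_gt_at_top[of 0]
  proof eventually_elim
    case (elim n)
    then show ?case using xi_max_stable[OF K elim] compl[of n] by simp
  qed
  moreover have "(\<lambda>n. (1 - ?p n) ^ n) \<longlonglongrightarrow> exp (- exponent K)"
    by (intro power_one_minus_tendsto_exp xi_exceedance K) auto
  ultimately have "(\<lambda>n::nat. ?F) \<longlonglongrightarrow> exp (- exponent K)" by (simp add: tendsto_cong)
  then show ?thesis by (simp add: LIMSEQ_const_iff)
qed

text \<open>Extracting the n-th root in \<open>maxima_cdf\<close> gives the tail of \<eta> along
  integers. Monotonicity in y extends it to real levels, which is required because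
  \<open>a n\<close> need not be an integer.\<close>

lemma eta_exceedance:
  assumes K: "finite K" "\<forall>(s, r)\<in>K. 0 < r"
  shows "((\<lambda>y. y * measure M {\<omega> \<in> space M. \<exists>(s, r)\<in>K. y * r < \<eta> \<omega> s}) \<longlongrightarrow> exponent K) at_top"
proof -
  interpret M: prob_space M by (rule M)
  let ?p = "\<lambda>y. measure M {\<omega> \<in> space M. \<exists>(s, r)\<in>K. y * r < \<eta> \<omega> s}"
  have ev: "{\<omega> \<in> space M. \<exists>(s, r)\<in>K. y * r < \<eta> \<omega> s} \<in> sets M" for y
    using K(1) by (intro sets.sets_Collect_finite_Ex) (auto simp: case_prod_beta')
  have "space M - {\<omega> \<in> space M. \<exists>(s, r)\<in>K. y * r < \<eta> \<omega> s} = {\<omega> \<in> space M. \<forall>(s, r)\<in>K. \<eta> \<omega> s \<le> y * r}" for y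
    by (fastforce simp: not_less case_prod_beta')
  then have "1 - ?p y = measure M {\<omega> \<in> space M. \<forall>(s, r)\<in>K. \<eta> \<omega> s \<le> y * r}" for y
    using M.prob_compl[OF ev[of y]] by simp
  then have "(\<lambda>n. (1 - ?p (real n)) ^ n) \<longlonglongrightarrow> exp (- exponent K)"
    using maxima_cdf[OF K] xi_cdf[OF K] by simp
  then have "(\<lambda>n. real n * (1 - (1 - ?p (real n)))) \<longlonglongrightarrow> exponent K"
    by (intro one_minus_root_asymptotics) auto
  then have "(\<lambda>n. real n * ?p (real n)) \<longlonglongrightarrow> exponent K" by simp
  then show ?thesis
  proof (rule antimono_scaled_at_top)
    fix x y :: real assume xy: "0 \<le> x" "x \<le> y"
    show "?p y \<le> ?p x"
    proof (rule M.finite_measure_mono[OF _ ev], clarify)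
      fix \<omega> s r assume "(s, r) \<in> K" "y * r < \<eta> \<omega> s"
      moreover have "x * r \<le> y * r" using xy K(2) calculation by (intro mult_right_mono) auto
      ultimately show "\<exists>(s, r)\<in>K. x * r < \<eta> \<omega> s" by (intro bexI[of _ "(s, r)"]) auto
    qed
  qed auto
qed

end

subsection \<open>The conditional limit\<close>

lemma emeasure_pareto_greaterThan:
  assumes "1 \<le> x"
  shows "emeasure pareto {x<..} = ennreal (1 / x)"
proof -
  have "emeasure pareto {x<..} = emeasure frechet_intensity {x<..}"
    unfolding pareto_def frechet_intensity_def using assms
    by (simp add: emeasure_density) (auto intro!: nn_integral_cong split: split_indicator)
  then show ?thesis using emeasure_frechet_intensity[of x] assms by simp
qed

lemma sets_pareto[simp, measurable_cong]: "sets pareto = sets borel"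
  by (simp add: pareto_def)

lemma space_pareto[simp]: "space pareto = UNIV"
  by (simp add: pareto_def)

lemma AE_pareto: "AE z in pareto. 1 \<le> z"
  unfolding pareto_def by (subst AE_density) (auto split: split_indicator)

lemma prob_space_pareto: "prob_space pareto"
proof (rule prob_spaceI)
  have "emeasure pareto (space pareto) = (\<integral>\<^sup>+u. ennreal (1 / u\<^sup>2) * indicator {1..} u \<partial>lborel)"
    unfolding pareto_def by (simp add: emeasure_density) (auto intro!: nn_integral_cong split: split_indicator)
  also have "\<dots> = ennreal (0 - (- 1 / 1))"
  proof (rule nn_integral_FTC_atLeast[where F="\<lambda>u. - 1 / u"])
    show "((\<lambda>u::real. - 1 / u) has_real_derivative 1 / y\<^sup>2) (at y)" if "1 \<le> y" for y
      using that by (auto intro!: derivative_eq_intros simp: power2_eq_square)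
    show "((\<lambda>u::real. - 1 / u) \<longlongrightarrow> 0) at_top" by real_asymp
  qed auto
  finally show "emeasure pareto (space pareto) = 1" by simp
qed

text \<open>Truncation of \<^term>\<open>ennreal\<close> at \<open>0\<close> covers the case \<open>c > 1\<close>.\<close>
lemma emeasure_pareto_scaled:
  assumes "0 \<le> c"
  shows "emeasure pareto {z. z * c \<le> 1} = ennreal (1 - c)"
proof -
  interpret prob_space pareto by (rule prob_space_pareto)
  consider "c = 0" | "0 < c" "c \<le> 1" | "1 < c" using assms by linarith
  then show ?thesis
  proof cases
    case 1
    then show ?thesis using emeasure_space_1 by simp
  next
    case 2
    have "{z. z * c \<le> 1} = space pareto - {1 / c<..}" using 2 by (auto simp: not_less field_simps)
    then have "measure pareto {z. z * c \<le> 1} = 1 - measure pareto {1 / c<..}"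
      using prob_compl[of "{1 / c<..}"] by simp
    moreover have "measure pareto {1 / c<..} = c"
      using emeasure_pareto_greaterThan[of "1 / c"] 2 by (simp add: measure_def)
    ultimately show ?thesis by (simp add: emeasure_eq_measure)
  next
    case 3
    have "emeasure pareto {z. z * c \<le> 1} = emeasure pareto {}"
    proof (rule emeasure_eq_AE)
      show "AE z in pareto. z \<in> {z. z * c \<le> 1} \<longleftrightarrow> z \<in> {}"
        using AE_pareto
      proof eventually_elim
        case (elim z)
        have "1 * c \<le> z * c" using elim assms by (intro mult_right_mono) auto
        then have "\<not> z * c \<le> 1" using 3 by linarith
        then show ?case by simp
      qed
    qed auto
    then show ?thesis using 3 by (simp add: ennreal_neg)
  qed
qed

text \<open>Continuity is given on a subset that need not be the whole space, whereas Borel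
  measurability of continuous functions is wanted globally. Precomposition with
  \<open>restrict\<close> extends \<open>f\<close> continuously: each coordinate of
  \<open>restrict\<close> is either a projection or the constant \<open>undefined\<close>.
  Countability of the index type lets measurability be checked coordinatewise.\<close>

lemma continuous_on_PiE_measurable:
  fixes f :: "real \<times> ('i::countable \<Rightarrow> real) \<Rightarrow> real"
  assumes "continuous_on (UNIV \<times> PiE I (\<lambda>_. UNIV)) f"
  shows "f \<in> borel_measurable (borel \<Otimes>\<^sub>M PiM I (\<lambda>_. borel))"
proof -
  have "continuous_on UNIV (\<lambda>p::real \<times> ('i \<Rightarrow> real). f (fst p, restrict (snd p) I))"
  proof (rule continuous_on_compose2[OF assms])
    have "continuous_on UNIV (\<lambda>p::real \<times> ('i \<Rightarrow> real). restrict (snd p) I i)" for i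
    proof (cases "i \<in> I")
      case True
      then show ?thesis
        by (simp, intro continuous_on_compose2[OF continuous_on_product_coordinates continuous_on_snd[OF continuous_on_id]]) auto
    qed simp
    then have "continuous_on UNIV (\<lambda>p::real \<times> ('i \<Rightarrow> real). restrict (snd p) I)"
      by (rule continuous_on_coordinatewise_then_product)
    then show "continuous_on UNIV (\<lambda>p::real \<times> ('i \<Rightarrow> real). (fst p, restrict (snd p) I))"
      by (intro continuous_on_Pair continuous_on_fst[OF continuous_on_id])
  qed auto
  then have [measurable]: "(\<lambda>p::real \<times> ('i \<Rightarrow> real). f (fst p, restrict (snd p) I)) \<in> borel_measurable borel"
    by (rule borel_measurable_continuous_onI)
  have "snd \<in> borel_measurable (borel \<Otimes>\<^sub>M PiM I (\<lambda>_. borel) :: (real \<times> ('i \<Rightarrow> real)) measure)"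
  proof (rule measurable_coordinatewise_then_product)
    fix i
    show "(\<lambda>p. snd p i) \<in> borel_measurable (borel \<Otimes>\<^sub>M PiM I (\<lambda>_. borel) :: (real \<times> ('i \<Rightarrow> real)) measure)"
    proof (cases "i \<in> I")
      case False
      have "snd p i = undefined" if "p \<in> space (borel \<Otimes>\<^sub>M PiM I (\<lambda>_. borel) :: (real \<times> ('i \<Rightarrow> real)) measure)" for p
        using that False by (cases p) (auto simp: space_pair_measure space_PiM intro: PiE_arb)
      then show ?thesis by (rule measurable_cong[THEN iffD2]) simp_all
    qed measurable
  qed
  then have "(\<lambda>p. (fst p, snd p)) \<in> borel_measurable (borel \<Otimes>\<^sub>M PiM I (\<lambda>_. borel) :: (real \<times> ('i \<Rightarrow> real)) measure)"
    by (intro borel_measurable_Pair) auto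
  then have F: "(\<lambda>p. f (fst (fst p, snd p), restrict (snd (fst p, snd p)) I)) \<in> borel_measurable (borel \<Otimes>\<^sub>M PiM I (\<lambda>_. borel))"
    by (rule measurable_compose) measurable
  have "f p = f (fst (fst p, snd p), restrict (snd (fst p, snd p)) I)"
    if "p \<in> space (borel \<Otimes>\<^sub>M PiM I (\<lambda>_. borel) :: (real \<times> ('i \<Rightarrow> real)) measure)" for p
    using that by (cases p) (auto simp: space_pair_measure space_PiM PiE_restrict)
  then show ?thesis using F by (rule measurable_cong[THEN iffD2])
qed

section \<open>The tilted law of the increments\<close>

context max_domain
begin

lemma Q_pos_eq:
  "1 - measure Q {\<omega> \<in> space Q. V \<omega> t0 = 0} = measure Q {\<omega> \<in> space Q. 0 < V \<omega> t0}"
proof -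
  interpret Q: prob_space Q by (rule Q)
  have "{\<omega> \<in> space Q. V \<omega> t0 = 0} \<in> sets Q" by measurable
  moreover have "space Q - {\<omega> \<in> space Q. V \<omega> t0 = 0} = {\<omega> \<in> space Q. 0 < V \<omega> t0}"
    using V_nonneg[of _ t0] by (force simp: less_le)
  ultimately show ?thesis using Q.prob_compl by metis
qed

text \<open>A mean of 1 rules out that V(t0) vanishes almost surely, so conditioning on V(t0) > 0 is
  legitimate.\<close>

lemma Q_pos: "0 < measure Q {\<omega> \<in> space Q. 0 < V \<omega> t0}"
proof (rule ccontr)
  interpret Q: prob_space Q by (rule Q)
  assume "\<not> 0 < measure Q {\<omega> \<in> space Q. 0 < V \<omega> t0}"
  then have "measure Q {\<omega> \<in> space Q. 0 < V \<omega> t0} = 0" using measure_nonneg[of Q] by (auto simp: not_less intro: antisym)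
  moreover have "{\<omega> \<in> space Q. 0 < V \<omega> t0} \<in> sets Q" by measurable
  ultimately have "AE \<omega> in Q. \<not> 0 < V \<omega> t0"
    by (subst AE_iff_measurable[OF _ refl]) (auto simp: Q.emeasure_eq_measure)
  then have "AE \<omega> in Q. V \<omega> t0 = 0" using AE_space
    by eventually_elim (use V_nonneg[of _ t0] in force)
  then have "(\<integral>\<omega>. V \<omega> t0 \<partial>Q) = 0" by (subst integral_cong_AE[where g="\<lambda>_. 0"]) auto
  then show False using V_mean[of t0] by simp
qed

lemma increments_measurable[measurable]:
  assumes [measurable]: "X \<in> measurable R process_space"
  shows "(\<lambda>\<omega>. \<lambda>j\<in>{1..k}. X \<omega> (t j) / X \<omega> t0) \<in> measurable R (PiM {1..k} (\<lambda>_. borel))"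
  by measurable

text \<open>The normalising constant of the conditional law cancels the factor \<open>1 - p\<close>.\<close>
lemma tilted_increments_eq:
  "tilted_increments Q V t0 k t = distr (density Q (\<lambda>\<omega>. ennreal (V \<omega> t0))) (PiM {1..k} (\<lambda>_. borel))
     (\<lambda>\<omega>. \<lambda>j\<in>{1..k}. V \<omega> (t j) / V \<omega> t0)"
proof -
  interpret Q: prob_space Q by (rule Q)
  let ?B = "{\<omega> \<in> space Q. 0 < V \<omega> t0}"
  let ?b = "measure Q ?B"
  have B[measurable]: "?B \<in> sets Q" by measurable
  have "density (uniform_measure Q ?B) (\<lambda>\<omega>. ennreal (?b * V \<omega> t0)) =
     density Q (\<lambda>\<omega>. indicator ?B \<omega> / emeasure Q ?B * ennreal (?b * V \<omega> t0))"
    unfolding uniform_measure_def by (intro density_density_eq) measurable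
  also have "\<dots> = density Q (\<lambda>\<omega>. ennreal (V \<omega> t0))"
  proof (rule density_cong)
    show "AE \<omega> in Q. indicator ?B \<omega> / emeasure Q ?B * ennreal (?b * V \<omega> t0) = ennreal (V \<omega> t0)"
    proof (rule AE_I2)
      fix \<omega> assume w: "\<omega> \<in> space Q"
      show "indicator ?B \<omega> / emeasure Q ?B * ennreal (?b * V \<omega> t0) = ennreal (V \<omega> t0)"
      proof (cases "0 < V \<omega> t0")
        case True
        have "(1::ennreal) / emeasure Q ?B = ennreal (1 / ?b)"
          using Q_pos[of t0] by (simp add: Q.emeasure_eq_measure divide_ennreal flip: ennreal_1)
        then show ?thesis using True w Q_pos[of t0] by (simp add: ennreal_mult[symmetric])
      next
        case False
        then show ?thesis using V_nonneg[OF w, of t0] by simp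
      qed
    qed
  qed measurable
  finally show ?thesis unfolding tilted_increments_def Let_def Q_pos_eq by simp
qed

lemma prob_space_tilted: "prob_space (tilted_increments Q V t0 k t)"
  unfolding tilted_increments_eq
proof (rule prob_space.prob_space_distr)
  show "prob_space (density Q (\<lambda>\<omega>. ennreal (V \<omega> t0)))"
  proof (rule prob_spaceI)
    have "emeasure (density Q (\<lambda>\<omega>. ennreal (V \<omega> t0))) (space (density Q (\<lambda>\<omega>. ennreal (V \<omega> t0)))) = (\<integral>\<^sup>+\<omega>. ennreal (V \<omega> t0) \<partial>Q)"
      by (subst emeasure_density) (auto intro!: nn_integral_cong)
    also have "\<dots> = ennreal (\<integral>\<omega>. V \<omega> t0 \<partial>Q)"
      using V_int V_nonneg by (intro nn_integral_eq_integral) auto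
    finally show "emeasure (density Q (\<lambda>\<omega>. ennreal (V \<omega> t0))) (space (density Q (\<lambda>\<omega>. ennreal (V \<omega> t0)))) = 1"
      using V_mean by simp
  qed
qed measurable

lemma sets_tilted[simp, measurable_cong]: "sets (tilted_increments Q V t0 k t) = sets (PiM {1..k} (\<lambda>_. borel))"
  unfolding tilted_increments_eq by simp

end

section \<open>Passage between values and increments\<close>

text \<open>Every index outside \<open>{1..k}\<close> is sent to \<open>t0\<close>, with index 0 as
  the one that is read back. This makes the vector of values a point of the full space
  \<open>nat \<Rightarrow> real\<close>, where the criterion of weak convergence lives.\<close>

definition sites :: "'t \<Rightarrow> (nat \<Rightarrow> 't) \<Rightarrow> nat \<Rightarrow> nat \<Rightarrow> 't" where
  "sites t0 t k j = (if j \<in> {1..k} then t j else t0)"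

text \<open>Undoes the passage to increments: the coordinates outside \<open>{1..k}\<close> carry the value at \<open>t0\<close>.\<close>
definition unscale :: "nat \<Rightarrow> real \<times> (nat \<Rightarrow> real) \<Rightarrow> nat \<Rightarrow> real" where
  "unscale k p j = fst p * (if j \<in> {1..k} then snd p j else 1)"

text \<open>The division by \<open>max 1 (x 0)\<close> makes this continuous everywhere; only \<open>x 0 \<ge> 1\<close> matters.\<close>
definition rescale :: "nat \<Rightarrow> (nat \<Rightarrow> real) \<Rightarrow> real \<times> (nat \<Rightarrow> real)" where
  "rescale k x = (max 1 (x 0), \<lambda>j\<in>{1..k}. x j / max 1 (x 0))"

lemma rescale_unscale:
  assumes "1 \<le> fst p" "snd p \<in> PiE {1..k} (\<lambda>_. UNIV)"
  shows "rescale k (unscale k p) = p"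
proof -
  have m: "max 1 (unscale k p 0) = fst p" using assms(1) by (simp add: unscale_def)
  have "(\<lambda>j\<in>{1..k}. unscale k p j / max 1 (unscale k p 0)) = (\<lambda>j\<in>{1..k}. snd p j)"
    unfolding m using assms(1) by (intro restrict_ext) (auto simp: unscale_def)
  also have "\<dots> = snd p" using assms(2) by (rule PiE_restrict)
  finally show ?thesis by (simp add: rescale_def m prod_eq_iff)
qed

lemma continuous_rescale: "continuous_on UNIV (rescale k)"
proof -
  have c: "continuous_on UNIV (\<lambda>x. max 1 (x (0::nat)) :: real)"
    by (intro continuous_intros continuous_on_product_coordinates)
  have "continuous_on UNIV (\<lambda>x. (\<lambda>j\<in>{1..k}. x j / max 1 (x 0) :: real) i)" for i
    by (cases "i \<in> {1..k}") (auto intro!: continuous_intros c continuous_on_product_coordinates)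
  then have "continuous_on UNIV (\<lambda>x. \<lambda>j\<in>{1..k}. x j / max 1 (x 0) :: real)"
    by (rule continuous_on_coordinatewise_then_product)
  then show ?thesis unfolding rescale_def[abs_def] by (intro continuous_on_Pair c)
qed

lemma unscale_measurable[measurable]:
  "unscale k \<in> borel_measurable (borel \<Otimes>\<^sub>M PiM {1..k} (\<lambda>_. borel))"
proof (rule measurable_coordinatewise_then_product)
  fix j show "(\<lambda>p. unscale k p j) \<in> borel_measurable (borel \<Otimes>\<^sub>M PiM {1..k} (\<lambda>_. borel))"
    unfolding unscale_def by (cases "j \<in> {1..k}") auto
qed

section \<open>The limit law and its distribution function\<close>

context max_domain
begin

definition limit_law :: "'t \<Rightarrow> nat \<Rightarrow> (nat \<Rightarrow> 't) \<Rightarrow> (nat \<Rightarrow> real) measure" where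
  "limit_law t0 k t = distr (pareto \<Otimes>\<^sub>M tilted_increments Q V t0 k t) borel (unscale k)"

lemma limit_unscale_measurable: "unscale k \<in> borel_measurable (pareto \<Otimes>\<^sub>M tilted_increments Q V t0 k t)"
  using unscale_measurable[of k] by (simp cong: measurable_cong_sets)

lemma limit_AE: "AE p in pareto \<Otimes>\<^sub>M tilted_increments Q V t0 k t. 1 \<le> fst p"
proof -
  interpret T: prob_space "tilted_increments Q V t0 k t" by (rule prob_space_tilted)
  have "AE z in distr (pareto \<Otimes>\<^sub>M tilted_increments Q V t0 k t) pareto fst. 1 \<le> z"
    unfolding T.distr_pair_fst by (rule AE_pareto)
  then show ?thesis by (rule AE_distrD[rotated]) simp
qed

lemma prob_space_limit: "prob_space (pareto \<Otimes>\<^sub>M tilted_increments Q V t0 k t)"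
proof -
  interpret T: prob_space "tilted_increments Q V t0 k t" by (rule prob_space_tilted)
  interpret Z: prob_space pareto by (rule prob_space_pareto)
  interpret pair_prob_space pareto "tilted_increments Q V t0 k t" ..
  show ?thesis by unfold_locales
qed

text \<open>max(v, w) - w is the positive part of v - w, and \<open>ennreal\<close> performs the
  truncation at 0.\<close>

lemma exponent_insert_diff:
  assumes "finite K"
  shows "(\<integral>\<^sup>+\<omega>. ennreal (V \<omega> t0 - tail_max K (V \<omega>)) \<partial>Q) = ennreal (exponent (insert (t0, 1) K) - exponent K)"
proof -
  have "ennreal (V \<omega> t0 - tail_max K (V \<omega>)) = ennreal (tail_max (insert (t0, 1) K) (V \<omega>) - tail_max K (V \<omega>))" for \<omega>
    using assms by (auto simp: tail_max_insert max_def ennreal_neg)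
  then have "(\<integral>\<^sup>+\<omega>. ennreal (V \<omega> t0 - tail_max K (V \<omega>)) \<partial>Q) =
     (\<integral>\<^sup>+\<omega>. ennreal (tail_max (insert (t0, 1) K) (V \<omega>) - tail_max K (V \<omega>)) \<partial>Q)" by simp
  also have "\<dots> = ennreal (\<integral>\<omega>. tail_max (insert (t0, 1) K) (V \<omega>) - tail_max K (V \<omega>) \<partial>Q)"
    using assms V_int by (intro nn_integral_eq_integral Bochner_Integration.integrable_diff tail_max_integrable)
      (auto simp: tail_max_insert)
  also have "\<dots> = ennreal (exponent (insert (t0, 1) K) - exponent K)"
    unfolding exponent_def using assms V_int
    by (subst Bochner_Integration.integral_diff) (auto intro!: tail_max_integrable)
  finally show ?thesis .
qed

lemma exponent_insert_ge: "finite K \<Longrightarrow> exponent K \<le> exponent (insert p K)"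
  unfolding exponent_def using V_int
  by (cases p, intro integral_mono tail_max_integrable) (auto simp: tail_max_insert)

lemma exponent_t0: "exponent {(t0, 1)} = 1"
proof -
  have "exponent {(t0, 1)} = (\<integral>\<omega>. V \<omega> t0 \<partial>Q)"
    unfolding exponent_def using V_nonneg[of _ t0]
    by (intro Bochner_Integration.integral_cong) (auto simp: tail_max_insert)
  then show ?thesis using V_mean by simp
qed

text \<open>Given increments w, the box becomes the event Z c(w) \<le> 1, of Pareto probability (1 -
  c(w))^+. Under the density V(t0), homogeneity of \<open>tail_max\<close> turns V(t0) c(w) into the
  gauge of V itself, which leaves the positive part treated in
  \<open>exponent_insert_diff\<close>.\<close>

lemma limit_law_orthant:
  fixes t0 :: 't and k :: nat and t :: "nat \<Rightarrow> 't"
  assumes K: "finite K" "\<forall>(j, r)\<in>K. 0 < r"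
  defines "K' \<equiv> (\<lambda>(j, r). (sites t0 t k j, r)) ` K"
  shows "measure (limit_law t0 k t) {x. \<forall>(j, r)\<in>K. x j \<le> r} = exponent (insert (t0, 1) K') - exponent K'"
proof -
  let ?T = "tilted_increments Q V t0 k t"
  let ?S = "{x::nat \<Rightarrow> real. \<forall>(j, r)\<in>K. x j \<le> r}"
  interpret T: prob_space ?T by (rule prob_space_tilted)
  interpret Z: prob_space pareto by (rule prob_space_pareto)
  interpret ZT: pair_prob_space pareto ?T ..
  define c where "c w = tail_max K (\<lambda>j. if j \<in> {1..k} then w j else 1)" for w
  have cm[measurable]: "c \<in> borel_measurable (PiM {1..k} (\<lambda>_. borel))"
    unfolding c_def
  proof (rule tail_max_measurable[OF K(1)])
    fix j show "(\<lambda>w. if j \<in> {1..k} then w j else 1) \<in> borel_measurable (PiM {1..k} (\<lambda>_. borel))"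
      by (cases "j \<in> {1..k}") auto
  qed
  have pre: "unscale k -` ?S \<inter> space (pareto \<Otimes>\<^sub>M ?T) \<in> sets (pareto \<Otimes>\<^sub>M ?T)"
    using limit_unscale_measurable orthant_sets by (rule measurable_sets)
  have "emeasure (limit_law t0 k t) ?S = emeasure (pareto \<Otimes>\<^sub>M ?T) (unscale k -` ?S \<inter> space (pareto \<Otimes>\<^sub>M ?T))"
    unfolding limit_law_def using limit_unscale_measurable orthant_sets by (rule emeasure_distr)
  also have "\<dots> = (\<integral>\<^sup>+w. emeasure pareto ((\<lambda>z. (z, w)) -` (unscale k -` ?S \<inter> space (pareto \<Otimes>\<^sub>M ?T))) \<partial>?T)"
    using pre by (rule ZT.emeasure_pair_measure_alt2)
  also have "\<dots> = (\<integral>\<^sup>+w. ennreal (1 - c w) \<partial>?T)"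
  proof (rule nn_integral_cong)
    fix w assume w: "w \<in> space ?T"
    have c0: "0 \<le> c w" unfolding c_def using K(1) by (rule tail_max_nonneg)
    have "emeasure pareto ((\<lambda>z. (z, w)) -` (unscale k -` ?S \<inter> space (pareto \<Otimes>\<^sub>M ?T))) = emeasure pareto {z. z * c w \<le> 1}"
    proof (rule emeasure_eq_AE)
      show "AE z in pareto. z \<in> (\<lambda>z. (z, w)) -` (unscale k -` ?S \<inter> space (pareto \<Otimes>\<^sub>M ?T)) \<longleftrightarrow> z \<in> {z. z * c w \<le> 1}"
        using AE_pareto
      proof eventually_elim
        case (elim z)
        have "z * c w = tail_max K (\<lambda>j. unscale k (z, w) j)"
          unfolding c_def unscale_def using K(1) elim
          by (subst tail_max_scale[symmetric]) (auto intro!: tail_max_cong)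
        then have "z * c w \<le> 1 \<longleftrightarrow> (\<forall>(j, r)\<in>K. unscale k (z, w) j \<le> 1 * r)"
          using tail_max_le[OF K, of 1] by simp
        then show ?case using w by (simp add: space_pair_measure)
      qed
      show "(\<lambda>z. (z, w)) -` (unscale k -` ?S \<inter> space (pareto \<Otimes>\<^sub>M ?T)) \<in> sets pareto"
        using pre by (rule sets_Pair2)
    qed simp
    then show "emeasure pareto ((\<lambda>z. (z, w)) -` (unscale k -` ?S \<inter> space (pareto \<Otimes>\<^sub>M ?T))) = ennreal (1 - c w)"
      using emeasure_pareto_scaled[OF c0] by simp
  qed
  also have "\<dots> = (\<integral>\<^sup>+\<omega>. ennreal (1 - c (\<lambda>j\<in>{1..k}. V \<omega> (t j) / V \<omega> t0)) \<partial>density Q (\<lambda>\<omega>. ennreal (V \<omega> t0)))"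
    unfolding tilted_increments_eq by (rule nn_integral_distr) measurable
  also have "\<dots> = (\<integral>\<^sup>+\<omega>. ennreal (V \<omega> t0) * ennreal (1 - c (\<lambda>j\<in>{1..k}. V \<omega> (t j) / V \<omega> t0)) \<partial>Q)"
    by (rule nn_integral_density) measurable
  also have "\<dots> = (\<integral>\<^sup>+\<omega>. ennreal (V \<omega> t0 - tail_max K' (V \<omega>)) \<partial>Q)"
  proof (rule nn_integral_cong)
    fix \<omega> assume w: "\<omega> \<in> space Q"
    have K': "finite K'" using K(1) by (simp add: K'_def)
    show "ennreal (V \<omega> t0) * ennreal (1 - c (\<lambda>j\<in>{1..k}. V \<omega> (t j) / V \<omega> t0)) = ennreal (V \<omega> t0 - tail_max K' (V \<omega>))"
    \<comment> \<open>Where V(t0) vanishes the increments are meaningless; the density annihilates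
      the left side and truncation the right side.\<close>
    proof (cases "V \<omega> t0 = 0")
      case True
      then show ?thesis using tail_max_nonneg[OF K', of "V \<omega>"] by (simp add: ennreal_neg)
    next
      case False
      then have v: "0 < V \<omega> t0" using V_nonneg[OF w, of t0] by simp
      have "V \<omega> t0 * c (\<lambda>j\<in>{1..k}. V \<omega> (t j) / V \<omega> t0) = tail_max K (\<lambda>j. V \<omega> (sites t0 t k j))"
        unfolding c_def using K(1) v
        by (subst tail_max_scale[symmetric]) (auto intro!: tail_max_cong simp: sites_def)
      also have "\<dots> = tail_max K' (V \<omega>)"
        unfolding tail_max_def K'_def by (simp add: image_image case_prod_beta')
      finally have "V \<omega> t0 * (1 - c (\<lambda>j\<in>{1..k}. V \<omega> (t j) / V \<omega> t0)) = V \<omega> t0 - tail_max K' (V \<omega>)"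
        by (simp add: right_diff_distrib)
      then show ?thesis using v by (simp add: ennreal_mult'[symmetric])
    qed
  qed
  also have "\<dots> = ennreal (exponent (insert (t0, 1) K') - exponent K')"
    using K(1) by (intro exponent_insert_diff) (simp add: K'_def)
  finally show ?thesis
    using exponent_insert_ge[of K' "(t0, 1)"] K(1) by (simp add: measure_def K'_def)
qed

text \<open>Covers the boxes with a negative threshold, which \<open>limit_law_orthant\<close>
  leaves out: almost surely Z \<ge> 1 and the increments are non-negative.\<close>

lemma limit_law_nonneg:
  assumes "r < 0"
  shows "measure (limit_law t0 k t) {x. x j \<le> r} = 0"
proof -
  let ?T = "tilted_increments Q V t0 k t"
  interpret ZT: prob_space "pareto \<Otimes>\<^sub>M ?T" by (rule prob_space_limit)
  interpret T: prob_space ?T by (rule prob_space_tilted)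
  interpret Z: prob_space pareto by (rule prob_space_pareto)
  interpret pair_prob_space pareto ?T ..
  have S: "{x::nat \<Rightarrow> real. x j \<le> r} \<in> sets borel"
    using orthant_sets[of "{(j, r)}"] by simp
  have T0: "AE w in ?T. \<forall>j\<in>{1..k}. 0 \<le> w j"
    unfolding tilted_increments_eq
  proof (subst AE_distr_iff)
    show "AE \<omega> in density Q (\<lambda>\<omega>. ennreal (V \<omega> t0)). \<forall>j\<in>{1..k}. 0 \<le> (\<lambda>j\<in>{1..k}. V \<omega> (t j) / V \<omega> t0) j"
      by (rule AE_I2) (auto intro!: divide_nonneg_nonneg V_nonneg)
  qed measurable
  have pre: "{p \<in> space (pareto \<Otimes>\<^sub>M ?T). \<not> unscale k p j \<le> r} \<in> sets (pareto \<Otimes>\<^sub>M ?T)"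
    using measurable_product_then_coordinatewise[OF limit_unscale_measurable[of k t0 t], of j] by measurable
  have "AE p in pareto \<Otimes>\<^sub>M ?T. \<not> unscale k p j \<le> r"
  proof (rule AE_pair_measure[OF pre])
    show "AE z in pareto. AE w in ?T. \<not> unscale k (z, w) j \<le> r"
      using AE_pareto
    proof eventually_elim
      case (elim z)
      show ?case using T0
      proof eventually_elim
        case (elim w)
        then have "0 \<le> unscale k (z, w) j" using \<open>1 \<le> z\<close> by (simp add: unscale_def)
        then show ?case using assms by simp
      qed
    qed
  qed
  then have "AE x in limit_law t0 k t. \<not> x j \<le> r"
    unfolding limit_law_def using S
    by (subst AE_distr_iff[OF limit_unscale_measurable]) (auto simp: Collect_neg_eq)
  then have "emeasure (limit_law t0 k t) {x. x j \<le> r} = 0"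
    using S by (subst (asm) AE_iff_measurable[OF _ refl]) (auto simp: limit_law_def)
  then show ?thesis by (simp add: measure_def)
qed

section \<open>Conditional convergence of \<eta>\<close>

text \<open>The joint event is the difference of two nested exceedance events, with and without the
  extra pair (t0, 1). Multiplying numerator and denominator by \<open>a n\<close> brings in the tail
  limits; the denominator tends to E V(t0) = 1.\<close>

lemma conditional_orthant:
  assumes K: "finite K" "\<forall>(s, r)\<in>K. 0 < r" and a: "filterlim a at_top sequentially"
  shows "(\<lambda>n. measure M ({\<omega> \<in> space M. a n < \<eta> \<omega> t0} \<inter> {\<omega> \<in> space M. \<forall>(s, r)\<in>K. \<eta> \<omega> s \<le> a n * r}) /
      measure M {\<omega> \<in> space M. a n < \<eta> \<omega> t0}) \<longlonglongrightarrow> exponent (insert (t0, 1) K) - exponent K"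
proof -
  interpret M: prob_space M by (rule M)
  let ?E = "\<lambda>K n. {\<omega> \<in> space M. \<exists>(s, r)\<in>K. a n * r < \<eta> \<omega> s}"
  let ?A = "\<lambda>n. {\<omega> \<in> space M. a n < \<eta> \<omega> t0}"
  have E: "?E K n \<in> sets M" if "finite K" for K n
    using that by (intro sets.sets_Collect_finite_Ex) (auto simp: case_prod_beta')
  have lim: "(\<lambda>n. a n * measure M (?E K n)) \<longlonglongrightarrow> exponent K" if "finite K" "\<forall>(s, r)\<in>K. 0 < r" for K
    using filterlim_compose[OF eta_exceedance[OF that] a] .
  have limA: "(\<lambda>n. a n * measure M (?A n)) \<longlonglongrightarrow> 1"
    using lim[of "{(t0, 1)}"] by (simp add: exponent_t0)
  have "measure M (?A n \<inter> {\<omega> \<in> space M. \<forall>(s, r)\<in>K. \<eta> \<omega> s \<le> a n * r}) =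
     measure M (?E (insert (t0, 1) K) n) - measure M (?E K n)" for n
  proof -
    have "?A n \<inter> {\<omega> \<in> space M. \<forall>(s, r)\<in>K. \<eta> \<omega> s \<le> a n * r} = ?E (insert (t0, 1) K) n - ?E K n"
      by (fastforce simp: not_less case_prod_beta')
    moreover have "?E K n \<subseteq> ?E (insert (t0, 1) K) n" by auto
    ultimately show ?thesis
      using M.finite_measure_Diff[of "?E (insert (t0, 1) K) n" "?E K n"] E[of K n] E[of "insert (t0, 1) K" n] K(1) by simp
  qed
  moreover have "(\<lambda>n. (a n * measure M (?E (insert (t0, 1) K) n) - a n * measure M (?E K n)) / (a n * measure M (?A n)))
    \<longlonglongrightarrow> (exponent (insert (t0, 1) K) - exponent K) / 1"
    by (intro tendsto_divide tendsto_diff lim limA) (use K in auto)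
  moreover have "\<forall>\<^sub>F n in sequentially. (a n * measure M (?E (insert (t0, 1) K) n) - a n * measure M (?E K n)) / (a n * measure M (?A n))
     = (measure M (?E (insert (t0, 1) K) n) - measure M (?E K n)) / measure M (?A n)"
    using filterlim_at_top_dense[THEN iffD1, OF a, rule_format, of 0]
  proof eventually_elim
    case (elim n)
    then show ?case by (simp only: right_diff_distrib[symmetric]) simp
  qed
  ultimately show ?thesis by (simp only: div_by_1 tendsto_cong)
qed

lemma eventually_exceed_pos:
  assumes a: "filterlim a at_top sequentially"
  shows "\<forall>\<^sub>F n in sequentially. 0 < a n \<and> 0 < measure M {\<omega> \<in> space M. a n < \<eta> \<omega> t0}"
proof -
  have "(\<lambda>n. a n * measure M {\<omega> \<in> space M. a n < \<eta> \<omega> t0}) \<longlonglongrightarrow> 1"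
    using filterlim_compose[OF eta_exceedance[of "{(t0, 1)}"] a] by (simp add: exponent_t0)
  then have "\<forall>\<^sub>F n in sequentially. 0 < a n * measure M {\<omega> \<in> space M. a n < \<eta> \<omega> t0}"
    by (rule order_tendstoD) simp
  then show ?thesis
    using filterlim_at_top_dense[THEN iffD1, OF a, rule_format, of 0]
    by eventually_elim (simp add: zero_less_mult_iff)
qed

text \<open>For small \<open>n\<close> the conditioning event may be null, where \<^term>\<open>uniform_measure\<close> is not a probability measure.\<close>
definition scaled_law :: "(nat \<Rightarrow> real) \<Rightarrow> 't \<Rightarrow> nat \<Rightarrow> (nat \<Rightarrow> 't) \<Rightarrow> nat \<Rightarrow> (nat \<Rightarrow> real) measure" where
  "scaled_law a t0 k t n =
    (if 0 < a n \<and> 0 < measure M {\<omega> \<in> space M. a n < \<eta> \<omega> t0}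
     then distr (uniform_measure M {\<omega> \<in> space M. a n < \<eta> \<omega> t0}) borel (\<lambda>\<omega> j. \<eta> \<omega> (sites t0 t k j) / a n)
     else limit_law t0 k t)"

lemma scaled_measurable: "(\<lambda>\<omega> j. \<eta> \<omega> (sites t0 t k j) / b) \<in> borel_measurable (uniform_measure M A)"
  by (intro measurable_coordinatewise_then_product) measurable

lemma scaled_law_weak_conv:
  assumes a: "filterlim a at_top sequentially"
  shows "weak_conv_on UNIV (scaled_law a t0 k t) (limit_law t0 k t)"
proof (rule weak_conv_on_of_orthants)
  interpret M: prob_space M by (rule M)
  let ?A = "\<lambda>n. {\<omega> \<in> space M. a n < \<eta> \<omega> t0}"
  let ?S = "\<lambda>K. {x::nat \<Rightarrow> real. \<forall>(j, r)\<in>K. x j \<le> r}"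
  have A[measurable]: "?A n \<in> sets M" for n by measurable
  show lp: "prob_space (limit_law t0 k t)"
    unfolding limit_law_def by (intro prob_space.prob_space_distr prob_space_limit limit_unscale_measurable)
  show "prob_space (scaled_law a t0 k t n)" for n
    using lp unfolding scaled_law_def
    by (auto intro!: prob_space.prob_space_distr prob_space_uniform_measure scaled_measurable simp: M.emeasure_eq_measure)
  show "sets (limit_law t0 k t) = sets borel" by (simp add: limit_law_def)
  show "sets (scaled_law a t0 k t n) = sets borel" for n by (simp add: limit_law_def scaled_law_def)
  show "countable (\<rat> - {0 :: real})" by (intro countable_Diff countable_rat)
  show "\<exists>d\<in>\<rat> - {0}. x < d \<and> d < y" if "x < y" for x y :: real
  proof (cases "0 \<le> x")
    case True
    then show ?thesis using Rats_dense_in_real[OF that] by force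
  next
    case False
    \<comment> \<open>Aiming below 0 as well keeps the rational found different from 0.\<close>
    then have "x < min y 0" using that by auto
    then show ?thesis using Rats_dense_in_real[of x "min y 0"] by force
  qed
  fix K :: "(nat \<times> real) set" assume K: "finite K" "K \<subseteq> UNIV \<times> (\<rat> - {0})"
  have law: "measure (scaled_law a t0 k t n) (?S K) =
      measure M (?A n \<inter> {\<omega> \<in> space M. \<forall>(j, r)\<in>K. \<eta> \<omega> (sites t0 t k j) \<le> a n * r}) / measure M (?A n)"
    if n: "0 < a n" "0 < measure M (?A n)" for n
  proof -
    have eq: "(\<lambda>\<omega> j. \<eta> \<omega> (sites t0 t k j) / a n) -` ?S K \<inter> space M = {\<omega> \<in> space M. \<forall>(j, r)\<in>K. \<eta> \<omega> (sites t0 t k j) \<le> a n * r}"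
      using n by (auto simp: pos_divide_le_eq mult.commute)
    have "(\<lambda>\<omega> j. \<eta> \<omega> (sites t0 t k j) / a n) -` ?S K \<inter> space M \<in> sets M"
      using measurable_sets[OF scaled_measurable[of t0 t k "a n" "?A n"] orthant_sets] by simp
    then have "measure (uniform_measure M (?A n)) ((\<lambda>\<omega> j. \<eta> \<omega> (sites t0 t k j) / a n) -` ?S K \<inter> space M) =
        measure M (?A n \<inter> {\<omega> \<in> space M. \<forall>(j, r)\<in>K. \<eta> \<omega> (sites t0 t k j) \<le> a n * r}) / measure M (?A n)"
      unfolding eq using n by (intro measure_uniform_measure) (auto simp: M.emeasure_eq_measure)
    then show ?thesis
      using n measure_distr[OF scaled_measurable[of t0 t k "a n" "?A n"] orthant_sets[of K]]
      unfolding scaled_law_def space_uniform_measure by (simp only: if_True simp_thms)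
  qed
  have ev: "\<forall>\<^sub>F n in sequentially. measure (scaled_law a t0 k t n) (?S K) =
      measure M (?A n \<inter> {\<omega> \<in> space M. \<forall>(j, r)\<in>K. \<eta> \<omega> (sites t0 t k j) \<le> a n * r}) / measure M (?A n)"
    using eventually_exceed_pos[OF a, of t0] by eventually_elim (simp add: law)
  show "(\<lambda>n. measure (scaled_law a t0 k t n) (?S K)) \<longlonglongrightarrow> measure (limit_law t0 k t) (?S K)"
  \<comment> \<open>As 0 is not a threshold, a box outside the first case has a negative threshold;
    then both measures are 0, the left one for large \<open>n\<close>.\<close>
  proof (cases "\<forall>(j, r)\<in>K. 0 < r")
    case True
    let ?K' = "(\<lambda>(j, r). (sites t0 t k j, r)) ` K"
    have "(\<lambda>n. measure M (?A n \<inter> {\<omega> \<in> space M. \<forall>(s, r)\<in>?K'. \<eta> \<omega> s \<le> a n * r}) / measure M (?A n))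
       \<longlonglongrightarrow> exponent (insert (t0, 1) ?K') - exponent ?K'"
      using K(1) True a by (intro conditional_orthant) auto
    moreover have "(\<forall>(s, r)\<in>?K'. \<eta> \<omega> s \<le> a n * r) \<longleftrightarrow> (\<forall>(j, r)\<in>K. \<eta> \<omega> (sites t0 t k j) \<le> a n * r)" for \<omega> n
      by (simp add: case_prod_beta')
    ultimately show ?thesis
      using ev limit_law_orthant[OF K(1) True, of t0 k t] by (simp add: tendsto_cong)
  next
    case False
    then obtain j r where jr: "(j, r) \<in> K" "r \<le> 0" by (auto simp: not_less)
    then have r: "r < 0" using K(2) by force
    interpret L: prob_space "limit_law t0 k t" by (rule lp)
    have "measure (limit_law t0 k t) (?S K) \<le> measure (limit_law t0 k t) {x. x j \<le> r}"
      using jr(1) orthant_sets[of "{(j, r)}"] by (intro L.finite_measure_mono) (auto simp: limit_law_def)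
    then have "measure (limit_law t0 k t) (?S K) = 0"
      using limit_law_nonneg[OF r, of t0 k t j] by (simp add: measure_le_0_iff)
    moreover have "\<forall>\<^sub>F n in sequentially. measure (scaled_law a t0 k t n) (?S K) = 0"
      using ev eventually_exceed_pos[OF a, of t0]
    proof eventually_elim
      case (elim n)
      have "{\<omega> \<in> space M. \<forall>(j, r)\<in>K. \<eta> \<omega> (sites t0 t k j) \<le> a n * r} = {}"
      proof safe
        fix \<omega> assume w: "\<omega> \<in> space M" "\<forall>(j, r)\<in>K. \<eta> \<omega> (sites t0 t k j) \<le> a n * r"
        then have "\<eta> \<omega> (sites t0 t k j) \<le> a n * r" using jr(1) by auto
        also have "a n * r < 0" using elim r by (simp add: mult_pos_neg)
        finally show "\<omega> \<in> {}" using eta_nonneg[OF w(1), of "sites t0 t k j"] by simp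
      qed
      then show ?case using elim(1) by (simp only: Int_empty_right measure_empty div_0)
    qed
    ultimately show ?thesis by (simp add: tendsto_cong)
  qed
qed

text \<open>A test function is continuous on the product set only. \<open>rescale\<close> maps the
  full space continuously into that set, so the composition is a valid test function for the
  rescaled values. The change of variables is exact almost surely in the limit, since Z \<ge> 1, and
  on the conditioning event before it.\<close>

lemma increments_weak_conv:
  assumes a: "filterlim a at_top sequentially"
  shows "weak_conv_on (UNIV \<times> PiE {1..k} (\<lambda>_. UNIV))
           (\<lambda>n. distr (uniform_measure M {\<omega> \<in> space M. a n < \<eta> \<omega> t0})
                   (borel \<Otimes>\<^sub>M PiM {1..k} (\<lambda>_. borel))
                   (\<lambda>\<omega>. (\<eta> \<omega> t0 / a n, \<lambda>j\<in>{1..k}. \<eta> \<omega> (t j) / \<eta> \<omega> t0)))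
           (pareto \<Otimes>\<^sub>M tilted_increments Q V t0 k t)"
  unfolding weak_conv_on_def
proof (intro allI impI, elim conjE)
  fix f :: "real \<times> (nat \<Rightarrow> real) \<Rightarrow> real"
  let ?S = "UNIV \<times> PiE {1..k} (\<lambda>_. UNIV) :: (real \<times> (nat \<Rightarrow> real)) set"
  let ?B = "borel \<Otimes>\<^sub>M PiM {1..k} (\<lambda>_. borel) :: (real \<times> (nat \<Rightarrow> real)) measure"
  assume f: "continuous_on ?S f" "bounded (f ` ?S)"
  have fm: "f \<in> borel_measurable ?B" using f(1) by (rule continuous_on_PiE_measurable)
  let ?g = "\<lambda>x. f (rescale k x)"
  have rS: "rescale k x \<in> ?S" for x by (auto simp: rescale_def)
  have gc: "continuous_on UNIV ?g"
    using rS by (intro continuous_on_compose2[OF f(1) continuous_rescale]) blast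
  have gm: "?g \<in> borel_measurable borel" using gc by (rule borel_measurable_continuous_onI)
  have "bounded (range ?g)" by (rule bounded_subset[OF f(2)]) (use rS in blast)
  then have lim: "(\<lambda>n. \<integral>x. ?g x \<partial>scaled_law a t0 k t n) \<longlonglongrightarrow> (\<integral>x. ?g x \<partial>limit_law t0 k t)"
    using scaled_law_weak_conv[OF a, of t0 k t] gc unfolding weak_conv_on_def by blast
  have "(\<integral>x. ?g x \<partial>limit_law t0 k t) = (\<integral>p. f (rescale k (unscale k p)) \<partial>(pareto \<Otimes>\<^sub>M tilted_increments Q V t0 k t))"
    unfolding limit_law_def by (rule integral_distr[OF limit_unscale_measurable gm])
  also have "\<dots> = (\<integral>p. f p \<partial>(pareto \<Otimes>\<^sub>M tilted_increments Q V t0 k t))"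
  proof (rule integral_cong_AE)
    show "(\<lambda>p. f (rescale k (unscale k p))) \<in> borel_measurable (pareto \<Otimes>\<^sub>M tilted_increments Q V t0 k t)"
      using limit_unscale_measurable gm by (rule measurable_compose)
    show "f \<in> borel_measurable (pareto \<Otimes>\<^sub>M tilted_increments Q V t0 k t)"
      using fm by (simp cong: measurable_cong_sets)
    show "AE p in pareto \<Otimes>\<^sub>M tilted_increments Q V t0 k t. f (rescale k (unscale k p)) = f p"
      using limit_AE AE_space
    proof eventually_elim
      case (elim p)
      have "space (tilted_increments Q V t0 k t) = PiE {1..k} (\<lambda>_. UNIV)"
        using sets_eq_imp_space_eq[OF sets_tilted[of t0 k t]] by (simp add: space_PiM)
      then have "snd p \<in> PiE {1..k} (\<lambda>_. UNIV)" using elim(2) by (auto simp: space_pair_measure)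
      then show ?case using elim(1) by (simp add: rescale_unscale)
    qed
  qed
  finally have l: "(\<integral>x. ?g x \<partial>limit_law t0 k t) = (\<integral>p. f p \<partial>(pareto \<Otimes>\<^sub>M tilted_increments Q V t0 k t))" .
  have "\<forall>\<^sub>F n in sequentially. (\<integral>x. ?g x \<partial>scaled_law a t0 k t n) =
    (\<integral>p. f p \<partial>distr (uniform_measure M {\<omega> \<in> space M. a n < \<eta> \<omega> t0}) ?B
        (\<lambda>\<omega>. (\<eta> \<omega> t0 / a n, \<lambda>j\<in>{1..k}. \<eta> \<omega> (t j) / \<eta> \<omega> t0)))"
    using eventually_exceed_pos[OF a, of t0]
  proof eventually_elim
    case (elim n)
    let ?U = "uniform_measure M {\<omega> \<in> space M. a n < \<eta> \<omega> t0}"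
    have A: "{\<omega> \<in> space M. a n < \<eta> \<omega> t0} \<in> sets M" by measurable
    have Gm: "(\<lambda>\<omega>. (\<eta> \<omega> t0 / a n, \<lambda>j\<in>{1..k}. \<eta> \<omega> (t j) / \<eta> \<omega> t0)) \<in> measurable ?U ?B" by measurable
    have "(\<integral>x. ?g x \<partial>scaled_law a t0 k t n) = (\<integral>\<omega>. ?g (\<lambda>j. \<eta> \<omega> (sites t0 t k j) / a n) \<partial>?U)"
      unfolding scaled_law_def using elim by (simp add: integral_distr[OF scaled_measurable gm])
    also have "\<dots> = (\<integral>\<omega>. f (\<eta> \<omega> t0 / a n, \<lambda>j\<in>{1..k}. \<eta> \<omega> (t j) / \<eta> \<omega> t0) \<partial>?U)"
    proof (rule integral_cong_AE)
      show "(\<lambda>\<omega>. ?g (\<lambda>j. \<eta> \<omega> (sites t0 t k j) / a n)) \<in> borel_measurable ?U"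
        using scaled_measurable gm by (rule measurable_compose)
      show "(\<lambda>\<omega>. f (\<eta> \<omega> t0 / a n, \<lambda>j\<in>{1..k}. \<eta> \<omega> (t j) / \<eta> \<omega> t0)) \<in> borel_measurable ?U"
        using Gm fm by (rule measurable_compose)
      show "AE \<omega> in ?U. ?g (\<lambda>j. \<eta> \<omega> (sites t0 t k j) / a n) = f (\<eta> \<omega> t0 / a n, \<lambda>j\<in>{1..k}. \<eta> \<omega> (t j) / \<eta> \<omega> t0)"
      proof (rule AE_uniform_measureI[OF A], rule AE_I2, rule impI)
        fix \<omega> assume "\<omega> \<in> {\<omega> \<in> space M. a n < \<eta> \<omega> t0}"
        \<comment> \<open>On the conditioning event \<open>max 1\<close> is inactive, and
          \<open>a n\<close> cancels from every quotient.\<close>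
        then have "1 < \<eta> \<omega> t0 / a n" "0 < \<eta> \<omega> t0" using elim by auto
        then have "rescale k (\<lambda>j. \<eta> \<omega> (sites t0 t k j) / a n) = (\<eta> \<omega> t0 / a n, \<lambda>j\<in>{1..k}. \<eta> \<omega> (t j) / \<eta> \<omega> t0)"
          using elim unfolding rescale_def by (auto simp: sites_def fun_eq_iff max_def)
        then show "?g (\<lambda>j. \<eta> \<omega> (sites t0 t k j) / a n) = f (\<eta> \<omega> t0 / a n, \<lambda>j\<in>{1..k}. \<eta> \<omega> (t j) / \<eta> \<omega> t0)"
          by simp
      qed
    qed
    finally show ?case using integral_distr[OF Gm fm] by simp
  qed
  with lim show "(\<lambda>n. \<integral>p. f p \<partial>distr (uniform_measure M {\<omega> \<in> space M. a n < \<eta> \<omega> t0}) ?B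
        (\<lambda>\<omega>. (\<eta> \<omega> t0 / a n, \<lambda>j\<in>{1..k}. \<eta> \<omega> (t j) / \<eta> \<omega> t0)))
     \<longlonglongrightarrow> (\<integral>p. f p \<partial>(pareto \<Otimes>\<^sub>M tilted_increments Q V t0 k t))"
    unfolding l by (simp add: tendsto_cong)
qed

end

theorem theorem2p1:
  fixes M :: "'a measure" and \<eta> :: "'a \<Rightarrow> 't \<Rightarrow> real"
    and N :: "'b measure" and \<eta>c :: "nat \<Rightarrow> 'b \<Rightarrow> 't \<Rightarrow> real"
    and P :: "'c measure" and \<xi> :: "'c \<Rightarrow> 't \<Rightarrow> real"
    and U :: "nat \<Rightarrow> 'c \<Rightarrow> real" and Vs :: "nat \<Rightarrow> 'c \<Rightarrow> 't \<Rightarrow> real"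
    and Q :: "'d measure" and V :: "'d \<Rightarrow> 't \<Rightarrow> real"
    and a :: "nat \<Rightarrow> real"
    and k :: nat and t0 :: 't and t :: "nat \<Rightarrow> 't"
  assumes M: "prob_space M" and N: "prob_space N" and P: "prob_space P" and Q: "prob_space Q"
    \<comment> \<open>the process V: non-negative with E V(s) = 1\<close>
    and V_meas: "V \<in> measurable Q process_space"
    and V_nonneg: "\<And>\<omega> s. \<omega> \<in> space Q \<Longrightarrow> 0 \<le> V \<omega> s"
    and V_int: "\<And>s. integrable Q (\<lambda>\<omega>. V \<omega> s)"
    and V_mean: "\<And>s. (\<integral>\<omega>. V \<omega> s \<partial>Q) = 1"
    \<comment> \<open>the max-stable process xi and its spectral representation\<close>
    and xi_meas: "\<xi> \<in> measurable P process_space"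
    and xi_frechet: "\<And>s x. 0 < x \<Longrightarrow> measure P {\<omega> \<in> space P. \<xi> \<omega> s \<le> x} = exp (- 1 / x)"
    and U_ppp: "frechet_ppp P U"
    and Vs_meas: "\<And>i. Vs i \<in> measurable P process_space"
    and Vs_indep: "prob_space.indep_vars P (\<lambda>_. process_space) Vs UNIV"
    and Vs_law: "\<And>i. distr P process_space (Vs i) = distr Q process_space V"
    and U_Vs_indep: "prob_space.indep_set P
       (sets (vimage_algebra (space P) (\<lambda>\<omega> i. U i \<omega>) (PiM UNIV (\<lambda>_. borel))))
       (sets (vimage_algebra (space P) (\<lambda>\<omega> i. Vs i \<omega>) (PiM UNIV (\<lambda>_. process_space))))"
    and xi_repr: "\<And>s. AE \<omega> in P. (\<exists>i. \<xi> \<omega> s = U i \<omega> * Vs i \<omega> s) \<and>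
                                  (\<forall>i. U i \<omega> * Vs i \<omega> s \<le> \<xi> \<omega> s)"
    \<comment> \<open>the non-negative process eta and its independent copies\<close>
    and eta_meas: "\<eta> \<in> measurable M process_space"
    and eta_nonneg: "\<And>\<omega> s. \<omega> \<in> space M \<Longrightarrow> 0 \<le> \<eta> \<omega> s"
    and etac_meas: "\<And>i. \<eta>c i \<in> measurable N process_space"
    and etac_indep: "prob_space.indep_vars N (\<lambda>_. process_space) \<eta>c UNIV"
    and etac_law: "\<And>i. distr N process_space (\<eta>c i) = distr M process_space \<eta>"
    \<comment> \<open>max-domain of attraction: (1/n) max_{i<=n} eta_i -> xi in finite-dimensional distributions\<close>
    and mda: "\<And>(m::nat) (s :: nat \<Rightarrow> 't).
       weak_conv_on (PiE {..<m} (\<lambda>_. UNIV))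
         (\<lambda>n. distr N (PiM {..<m} (\<lambda>_. borel))
                (\<lambda>\<omega>. \<lambda>j\<in>{..<m}. (MAX i\<in>{..<n}. \<eta>c i \<omega> (s j)) / real n))
         (distr P (PiM {..<m} (\<lambda>_. borel)) (\<lambda>\<omega>. \<lambda>j\<in>{..<m}. \<xi> \<omega> (s j)))"
    and a_lim: "filterlim a at_top sequentially"
  shows "weak_conv_on (UNIV \<times> PiE {1..k} (\<lambda>_. UNIV))
           (\<lambda>n. distr (uniform_measure M {\<omega> \<in> space M. a n < \<eta> \<omega> t0})
                   (borel \<Otimes>\<^sub>M PiM {1..k} (\<lambda>_. borel))
                   (\<lambda>\<omega>. (\<eta> \<omega> t0 / a n, \<lambda>j\<in>{1..k}. \<eta> \<omega> (t j) / \<eta> \<omega> t0)))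
           (pareto \<Otimes>\<^sub>M tilted_increments Q V t0 k t)"
proof -
  interpret prob_space P by (rule P)
  interpret max_domain P U Vs Q V M \<eta> N \<eta>c \<xi>
    by (intro max_domain.intro spectral_points.intro spectral_points_axioms.intro max_domain_axioms.intro) fact+
  show ?thesis by (rule increments_weak_conv[OF a_lim])
qed

end
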